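(* Let $X$ be a Banach space, let $U$ and $Y$ be Fréchet spaces, let $\Phi:\mathbb{T}\to\mathrm{End}(X)$ be a (strongly continuous) semigroup, and let $B:U\to X$, $C:X\to Y$, $D:U\to Y$ be continuous linear operators. Let $\mathcal{P}$ be the $(U,Y)$-relation consisting of all pairs $(u,y)\in C^\infty_{\mathrm{loc}}(\mathbb{T},U)\times C^\infty_{\mathrm{loc}}(\mathbb{T},Y)$ for which there exists $x\in C^\infty_{\mathrm{loc}}(\mathbb{T},X)$ such that for all $t\in\mathbb{T}$ $$x(t)=\Phi(t)x(0)+\int_{(0,t]}\Phi(t-s)Bu(s)\,ds,\qquad y(t)=Cx(t)+Du(t).$$ If $\Phi(1)$ is compact, then the following are equivalent: (a) $\mathcal{P}$ is stable. (b) Every generalized eigenvector of $\Phi(1)$ associated to an eigenvalue outside the open unit disk belongs to the unobservable subspace of $(\Phi,C)$. (c) $\mathcal{P}$ is VIVO. (d) $\mathcal{P}$ is smoothly VIVO.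
   Context: All vector spaces are over $\mathbb{C}$. $\mathbb{T}$ is either $\mathbb{R}_{\ge0}$ or $\mathbb{Z}_{\ge0}$; when $\mathbb{T}=\mathbb{Z}_{\ge0}$ the integral is taken with respect to counting measure. $\mathrm{End}(X)$ is the space of bounded linear operators on $X$. A (strongly continuous) semigroup is a map $\Phi:\mathbb{T}\to\mathrm{End}(X)$ with $\Phi(0)=\mathrm{id}_X$, $\Phi(t+s)=\Phi(t)\Phi(s)$ for all $t,s\in\mathbb{T}$, and $t\mapsto\Phi(t)x$ continuous for every $x\in X$ (vacuous if $\mathbb{T}=\mathbb{Z}_{\ge0}$). The unobservable subspace of $(\Phi,C)$ is the largest subspace of $\ker C$ invariant under every $\Phi(t)$, $t\in\mathbb{T}$. A generalized eigenvector of an operator $T$ associated to $\lambda$ is an element of $\bigcup_k\ker(\lambda-T)^k$. $C^\infty_{\mathrm{loc}}(\mathbb{R}_{\ge0},X)$ is the space of smooth functions $\mathbb{R}_{\ge0}\to X$; $C^\infty_{\mathrm{loc}}(\mathbb{Z}_{\ge0},X)$ is the space of all sequences in $X$. A $(U,Y)$-relation is a linear subspace of $C^\infty_{\mathrm{loc}}(\mathbb{T},U)\times C^\infty_{\mathrm{loc}}(\mathbb{T},Y)$ (pairs (input, output)) invariant under translation in time. A function $f$ is vanishing if $\lim_{t\to\infty}f(t)=0$; for $\mathbb{T}=\mathbb{R}_{\ge0}$ it is smoothly vanishing if $\lim_{t\to\infty}\partial_t^kf(t)=0$ for all $k\ge0$; for $\mathbb{T}=\mathbb{Z}_{\ge0}$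 "smoothly vanishing" is read as "vanishing". A relation $\mathcal{P}$ is stable if $y$ is vanishing whenever $(0,y)\in\mathcal{P}$; it is VIVO [smoothly VIVO] if for every $(u,y)\in\mathcal{P}$ with $u$ vanishing [smoothly vanishing], $y$ is vanishing [smoothly vanishing]. *)

theory Defs
  imports "HOL-Analysis.Analysis"
begin

section \<open>Complex vector spaces, Banach spaces and Frechet spaces\<close>

class complex_vector = real_vector +
  fixes scaleC :: "complex \<Rightarrow> 'a \<Rightarrow> 'a" (infixr \<open>*\<^sub>C\<close> 75)
  assumes scaleC_add_right: "a *\<^sub>C (x + y) = a *\<^sub>C x + a *\<^sub>C y"
    and scaleC_add_left: "(a + b) *\<^sub>C x = a *\<^sub>C x + b *\<^sub>C x"
    and scaleC_scaleC: "a *\<^sub>C b *\<^sub>C x = (a * b) *\<^sub>C x"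
    and scaleC_one: "1 *\<^sub>C x = x"
    and scaleR_eq_scaleC: "r *\<^sub>R x = complex_of_real r *\<^sub>C x"
begin

definition cseminorm :: "('a \<Rightarrow> real) \<Rightarrow> bool" where
  "cseminorm p \<longleftrightarrow>
     (\<forall>x y. p (x + y) \<le> p x + p y) \<and> (\<forall>c x. p (c *\<^sub>C x) = cmod c * p x)"

end

global_interpretation complex_vector:
  vector_space "scaleC :: complex \<Rightarrow> 'a \<Rightarrow> 'a::complex_vector"
  by standard (simp_all add: scaleC_add_right scaleC_add_left scaleC_scaleC scaleC_one)

class complex_banach = complex_vector + banach +
  assumes norm_scaleC: "norm (c *\<^sub>C x) = cmod c * norm x"

text \<open>
  A Frechet space is a Hausdorff space whose topology is generated by a countable
  family of seminorms and in which every Cauchy sequence converges. The vector space operations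
  are then automatically continuous.
\<close>

class frechet_space = complex_vector + t2_space +
  assumes frechet: "\<exists>p :: nat \<Rightarrow> 'a \<Rightarrow> real.
     (\<forall>n. cseminorm (p n)) \<and>
     (\<forall>S. open S \<longleftrightarrow> (\<forall>x\<in>S. \<exists>N. \<exists>e>0. {y. \<forall>n\<le>N. p n (y - x) < e} \<subseteq> S)) \<and>
     (\<forall>s :: nat \<Rightarrow> 'a.
        (\<forall>n. \<forall>e>0. \<exists>M. \<forall>i\<ge>M. \<forall>j\<ge>M. p n (s i - s j) < e) \<longrightarrow> (\<exists>l. s \<longlonglongrightarrow> l))"

instance complex_banach \<subseteq> frechet_space
proof
  let ?p = "\<lambda>_ :: nat. norm :: 'a \<Rightarrow> real"
  have "\<forall>n. cseminorm (?p n)"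
    by (simp add: cseminorm_def norm_triangle_ineq norm_scaleC)
  moreover have "open S \<longleftrightarrow> (\<forall>x\<in>S. \<exists>N::nat. \<exists>e>0. {y. \<forall>n\<le>N. ?p n (y - x) < e} \<subseteq> S)" for S
  proof -
    have "(\<forall>n\<le>N. ?p n z < e) \<longleftrightarrow> norm z < e" for N :: nat and z :: 'a and e
      by auto
    then show ?thesis
      by (simp only:) (simp add: open_dist dist_norm subset_eq)
  qed
  moreover have "\<exists>l. s \<longlonglongrightarrow> l"
    if "\<forall>n. \<forall>e>0. \<exists>M. \<forall>i\<ge>M. \<forall>j\<ge>M. ?p n (s i - s j) < e" for s
  proof -
    have "Cauchy s"
      using that by (simp add: Cauchy_def dist_norm)
    then show ?thesis
      by (simp add: Cauchy_convergent_iff convergent_def)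
  qed
  ultimately show "\<exists>p :: nat \<Rightarrow> 'a \<Rightarrow> real.
     (\<forall>n. cseminorm (p n)) \<and>
     (\<forall>S. open S \<longleftrightarrow> (\<forall>x\<in>S. \<exists>N. \<exists>e>0. {y. \<forall>n\<le>N. p n (y - x) < e} \<subseteq> S)) \<and>
     (\<forall>s :: nat \<Rightarrow> 'a.
        (\<forall>n. \<forall>e>0. \<exists>M. \<forall>i\<ge>M. \<forall>j\<ge>M. p n (s i - s j) < e) \<longrightarrow> (\<exists>l. s \<longlonglongrightarrow> l))"
    by (intro exI[of _ ?p]) blast
qed

instantiation complex :: complex_banach
begin

definition scaleC_complex :: "complex \<Rightarrow> complex \<Rightarrow> complex" where
  "scaleC_complex = (*)"

instance
  by standard (simp_all add: scaleC_complex_def algebra_simps scaleR_conv_of_real norm_mult)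

end

section \<open>Operators\<close>

definition continuous_clinear ::
    "('a::{complex_vector,topological_space} \<Rightarrow> 'b::{complex_vector,topological_space}) \<Rightarrow> bool" where
  "continuous_clinear f \<longleftrightarrow> Vector_Spaces.linear (*\<^sub>C) (*\<^sub>C) f \<and> continuous_on UNIV f"

definition bounded_clinear :: "('a::complex_banach \<Rightarrow> 'b::complex_banach) \<Rightarrow> bool" where
  "bounded_clinear f \<longleftrightarrow>
     Vector_Spaces.linear (*\<^sub>C) (*\<^sub>C) f \<and> (\<exists>K. \<forall>x. norm (f x) \<le> K * norm x)"

definition compact_operator :: "('a::complex_banach \<Rightarrow> 'b::complex_banach) \<Rightarrow> bool" where
  "compact_operator f \<longleftrightarrow>
     bounded_clinear f \<and> (\<forall>S. bounded S \<longrightarrow> compact (closure (f ` S)))"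

definition eigenvalue :: "('a::complex_vector \<Rightarrow> 'a) \<Rightarrow> complex \<Rightarrow> bool" where
  "eigenvalue F \<mu> \<longleftrightarrow> (\<exists>v. v \<noteq> 0 \<and> F v = \<mu> *\<^sub>C v)"

definition generalized_eigenvectors :: "('a::complex_vector \<Rightarrow> 'a) \<Rightarrow> complex \<Rightarrow> 'a set" where
  "generalized_eigenvectors F \<mu> = (\<Union>k. {v. ((\<lambda>w. \<mu> *\<^sub>C w - F w) ^^ k) v = 0})"

section \<open>Time sets and functions of time\<close>

text \<open>
  A time set is one of the subsets \<^term>\<open>{0..}\<close> and \<^term>\<open>\<nat>\<close> of the reals. A function
  on a time set \<open>T\<close> is represented by a function on the reals whose values outside
  \<open>T\<close> are irrelevant: every notion below only depends on the values on \<open>T\<close>.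
\<close>

definition time_set :: "real set \<Rightarrow> bool" where
  "time_set T \<longleftrightarrow> T = {0..} \<or> T = \<nat>"

text \<open>
  The derivative on \<^term>\<open>{0..}\<close> (one-sided at \<open>0\<close>), as a limit of difference quotients;
  the library's derivatives only cover normed spaces.
\<close>

definition diff_quotient :: "(real \<Rightarrow> 'a::real_vector) \<Rightarrow> real \<Rightarrow> real \<Rightarrow> 'a" where
  "diff_quotient f t s = (f s - f t) /\<^sub>R (s - t)"

definition time_differentiable :: "(real \<Rightarrow> 'a::{real_vector,t2_space}) \<Rightarrow> bool" where
  "time_differentiable f \<longleftrightarrow>
     (\<forall>t\<ge>0. \<exists>d. (diff_quotient f t \<longlongrightarrow> d) (at t within {0..}))"

definition time_deriv :: "(real \<Rightarrow> 'a::{real_vector,t2_space}) \<Rightarrow> real \<Rightarrow> 'a" where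
  "time_deriv f t = Lim (at t within {0..}) (diff_quotient f t)"

definition Cinf_loc :: "real set \<Rightarrow> (real \<Rightarrow> 'a::{real_vector,t2_space}) set" where
  "Cinf_loc T =
     (if T = {0..} then {f. \<forall>k. time_differentiable ((time_deriv ^^ k) f)} else UNIV)"

definition vanishing :: "real set \<Rightarrow> (real \<Rightarrow> 'a::{zero,topological_space}) \<Rightarrow> bool" where
  "vanishing T f \<longleftrightarrow> (f \<longlongrightarrow> 0) (inf at_top (principal T))"

definition smoothly_vanishing :: "real set \<Rightarrow> (real \<Rightarrow> 'a::{real_vector,t2_space}) \<Rightarrow> bool" where
  "smoothly_vanishing T f \<longleftrightarrow>
     (if T = {0..} then \<forall>k. vanishing T ((time_deriv ^^ k) f) else vanishing T f)"

text \<open>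
  The integral of \<open>f\<close> over \<open>A \<inter> T\<close>, with respect to counting measure if \<open>T\<close> is discrete.
  The Henstock-Kurzweil integral is used since the library's Bochner integral
  requires a separable codomain.
\<close>

definition time_integral :: "real set \<Rightarrow> real set \<Rightarrow> (real \<Rightarrow> 'a::banach) \<Rightarrow> 'a" where
  "time_integral T A f = (if T = {0..} then integral (A \<inter> T) f else sum f (A \<inter> T))"

section \<open>Semigroups and relations\<close>

definition semigroup_on :: "real set \<Rightarrow> (real \<Rightarrow> 'x::complex_banach \<Rightarrow> 'x) \<Rightarrow> bool" where
  "semigroup_on T \<Phi> \<longleftrightarrow>
     (\<forall>t\<in>T. bounded_clinear (\<Phi> t)) \<and>
     \<Phi> 0 = id \<and>
     (\<forall>t\<in>T. \<forall>s\<in>T. \<Phi> (t + s) = \<Phi> t \<circ> \<Phi> s) \<and>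
     (\<forall>x. continuous_on T (\<lambda>t. \<Phi> t x))"

definition unobservable_subspace ::
    "real set \<Rightarrow> (real \<Rightarrow> 'x::complex_vector \<Rightarrow> 'x) \<Rightarrow> ('x \<Rightarrow> 'y::zero) \<Rightarrow> 'x set" where
  "unobservable_subspace T \<Phi> C =
     (GREATEST V. complex_vector.subspace V \<and> V \<subseteq> {x. C x = 0} \<and> (\<forall>t\<in>T. \<Phi> t ` V \<subseteq> V))"

lemma unobservable_subspace_eq:
  assumes T: "time_set T" and \<Phi>: "semigroup_on T \<Phi>" and C: "Vector_Spaces.linear (*\<^sub>C) (*\<^sub>C) C"
  shows "unobservable_subspace T \<Phi> C = {x. \<forall>t\<in>T. C (\<Phi> t x) = 0}" (is "_ = ?N")
  unfolding unobservable_subspace_def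
proof (rule Greatest_equality)
  have T0: "0 \<in> T" and Tadd: "\<And>s t. s \<in> T \<Longrightarrow> t \<in> T \<Longrightarrow> s + t \<in> T"
    using T by (auto simp: time_set_def)
  have lin: "Vector_Spaces.linear (*\<^sub>C) (*\<^sub>C) (\<lambda>x. C (\<Phi> t x))" if "t \<in> T" for t
    using Vector_Spaces.linear_compose[of "(*\<^sub>C)" "(*\<^sub>C)" "\<Phi> t" "(*\<^sub>C)" C] \<Phi> C that
    by (simp add: semigroup_on_def bounded_clinear_def o_def)
  have "complex_vector.subspace {x. C (\<Phi> t x) = 0}" if "t \<in> T" for t
    using lin[OF that] by (intro module_hom.subspace_kernel) (simp add: Vector_Spaces.linear_iff_module_hom)
  then have "complex_vector.subspace (\<Inter>t\<in>T. {x. C (\<Phi> t x) = 0})"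
    by (intro complex_vector.subspace_Inter) auto
  also have "(\<Inter>t\<in>T. {x. C (\<Phi> t x) = 0}) = ?N"
    by auto
  finally have "complex_vector.subspace ?N" .
  moreover have "?N \<subseteq> {x. C x = 0}"
    using T0 \<Phi> by (force simp: semigroup_on_def)
  moreover have "\<Phi> t ` ?N \<subseteq> ?N" if "t \<in> T" for t
  proof clarify
    fix x s assume "\<forall>t\<in>T. C (\<Phi> t x) = 0" "s \<in> T"
    moreover have "\<Phi> s (\<Phi> t x) = \<Phi> (s + t) x"
      using \<Phi> \<open>s \<in> T\<close> that by (simp add: semigroup_on_def)
    ultimately show "C (\<Phi> s (\<Phi> t x)) = 0"
      using Tadd that by simp
  qed
  ultimately show "complex_vector.subspace ?N \<and> ?N \<subseteq> {x. C x = 0} \<and> (\<forall>t\<in>T. \<Phi> t ` ?N \<subseteq> ?N)"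
    by blast
qed blast

definition system_relation ::
    "real set \<Rightarrow> (real \<Rightarrow> 'x::complex_banach \<Rightarrow> 'x) \<Rightarrow> ('u::frechet_space \<Rightarrow> 'x) \<Rightarrow>
     ('x \<Rightarrow> 'y::frechet_space) \<Rightarrow> ('u \<Rightarrow> 'y) \<Rightarrow> ((real \<Rightarrow> 'u) \<times> (real \<Rightarrow> 'y)) set" where
  "system_relation T \<Phi> B C D =
     {(u, y). u \<in> Cinf_loc T \<and> y \<in> Cinf_loc T \<and>
        (\<exists>x\<in>Cinf_loc T. \<forall>t\<in>T.
           x t = \<Phi> t (x 0) + time_integral T {0<..t} (\<lambda>s. \<Phi> (t - s) (B (u s))) \<and>
           y t = C (x t) + D (u t))}"

definition is_stable ::
    "real set \<Rightarrow> ((real \<Rightarrow> 'u::frechet_space) \<times> (real \<Rightarrow> 'y::frechet_space)) set \<Rightarrow> bool" where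
  "is_stable T P \<longleftrightarrow> (\<forall>y. (\<lambda>_. 0, y) \<in> P \<longrightarrow> vanishing T y)"

definition VIVO ::
    "real set \<Rightarrow> ((real \<Rightarrow> 'u::frechet_space) \<times> (real \<Rightarrow> 'y::frechet_space)) set \<Rightarrow> bool" where
  "VIVO T P \<longleftrightarrow> (\<forall>(u, y)\<in>P. vanishing T u \<longrightarrow> vanishing T y)"

definition smoothly_VIVO ::
    "real set \<Rightarrow> ((real \<Rightarrow> 'u::frechet_space) \<times> (real \<Rightarrow> 'y::frechet_space)) set \<Rightarrow> bool" where
  "smoothly_VIVO T P \<longleftrightarrow>
     (\<forall>(u, y)\<in>P. smoothly_vanishing T u \<longrightarrow> smoothly_vanishing T y)"

end

theory Submission
  imports Defs
begin

text \<open>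
  Let \<open>S = \<Phi> 1\<close> and let \<open>H\<close> be the span of the generalized eigenvectors of \<open>S\<close> for
  eigenvalues outside the open unit disk. Riesz' lemma makes \<open>H\<close> finite-dimensional. Modulo \<open>H\<close>
  no eigenvalues of modulus at least 1 remain, so compactness bounds the operators \<open>1 - z S\<close> with
  \<open>\<bar>z\<bar> \<le> 1\<close> uniformly from below, and some power of \<open>S\<close> at least halves the distance to \<open>H\<close>.
  This is proved with the seminorm
  \<open>\<lambda>x. infdist x H\<close> on the whole space: no quotient space, spectral projection or complex
  integration is needed.

  (b) means \<open>H \<subseteq> ker C\<close> together with invariance of \<open>H\<close>; the state then converges to \<open>H\<close> under
  vanishing inputs, which gives (c). The time derivative of a pair in the relation is again such a
  pair, so (c) implies (d). If (a) holds, orbits in \<open>H\<close> are smooth since \<open>H\<close> is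
  finite-dimensional, hence produce vanishing outputs, and induction on the order of a generalized
  eigenvector \<open>v\<close> gives \<open>C (S\<^sup>n v) = \<mu>\<^sup>n C v \<longlonglongrightarrow> 0\<close> with \<open>\<bar>\<mu>\<bar> \<ge> 1\<close>, that is, \<open>C v = 0\<close>.
\<close>

section \<open>Complex linear maps and seminorms\<close>

text \<open>The obstacle is to turn absence of eigenvalues into decay, usually done by the spectral
  radius formula on X/H. Here a radius \<open>b\<close> moves from 0 to 1. If \<open>b^n S^n\<close>
  is small at one radius, averaging over the \<open>n\<close>-th roots of unity gives smallness at a
  slightly larger one. The step length depends only on the lower bound for \<open>1 - z S\<close>
  and on a bound for \<open>S\<close>, not on \<open>n\<close>, so finitely many steps reach radius
  1. As only a seminorm is at hand, inverses are replaced by truncated series and a priori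
  estimates.

  The relation admits only smooth states, while strong continuity alone does not make orbits smooth.
  Stability can therefore be tested only on vectors with smooth orbits. Finite dimension of
  \<open>H\<close> thus serves twice: it makes \<open>H\<close> closed, and it makes the orbits in
  \<open>H\<close> smooth.

  Strong continuity gives only pointwise bounds on \<open>\<Phi> t\<close>. Uniform boundedness
  converts them into operator bounds on bounded time intervals, on which the convolution estimates
  rest.\<close>

abbreviation clinear :: "('a::complex_vector \<Rightarrow> 'b::complex_vector) \<Rightarrow> bool" where
  "clinear f \<equiv> Vector_Spaces.linear (*\<^sub>C) (*\<^sub>C) f"

lemma clinear_add: "clinear f \<Longrightarrow> f (x + y) = f x + f y"
  and clinear_scaleC: "clinear f \<Longrightarrow> f (c *\<^sub>C x) = c *\<^sub>C f x"
  by (simp_all add: Vector_Spaces.linear_iff)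

lemma clinearI: "(\<And>x y. f (x + y) = f x + f y) \<Longrightarrow> (\<And>c x. f (c *\<^sub>C x) = c *\<^sub>C f x) \<Longrightarrow> clinear f"
  by (simp add: Vector_Spaces.linear_iff complex_vector.vector_space_axioms)

lemma clinear_0: "clinear f \<Longrightarrow> f 0 = 0"
  by (metis add_cancel_right_right clinear_add)

lemma clinear_diff: "clinear f \<Longrightarrow> f (x - y) = f x - f y"
  by (metis add_diff_cancel clinear_add diff_add_cancel)

lemma clinear_scaleR: "clinear f \<Longrightarrow> f (r *\<^sub>R x) = r *\<^sub>R f x"
  by (simp add: scaleR_eq_scaleC clinear_scaleC)

lemma clinear_funpow:
  fixes f :: "'a::complex_vector \<Rightarrow> 'a"
  shows "clinear f \<Longrightarrow> clinear (f ^^ n)"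
proof (induction n)
  case 0
  show ?case by (rule clinearI) simp_all
next
  case (Suc n)
  then show ?case by (intro clinearI) (simp_all add: clinear_add clinear_scaleC)
qed

lemma clinear_scaleC_minus: "clinear f \<Longrightarrow> clinear (\<lambda>x. c *\<^sub>C x - f x)"
  by (intro clinearI)
    (simp_all add: clinear_add clinear_scaleC scaleC_add_right complex_vector.scale_right_diff_distrib
      scaleC_scaleC mult.commute)

lemma cseminorm_triangle: "cseminorm p \<Longrightarrow> p (x + y) \<le> p x + p y"
  and cseminorm_scaleC: "cseminorm p \<Longrightarrow> p (c *\<^sub>C x) = cmod c * p x"
  by (simp_all add: cseminorm_def)

lemma cseminorm_0: "cseminorm p \<Longrightarrow> p 0 = 0"
  using cseminorm_scaleC[of p 0 0] by simp

lemma cseminorm_minus: "cseminorm p \<Longrightarrow> p (- x) = p x"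
  using cseminorm_scaleC[of p "-1" x] by simp

lemma cseminorm_minus_commute: "cseminorm p \<Longrightarrow> p (x - y) = p (y - x)"
  by (metis cseminorm_minus minus_diff_eq)

lemma cseminorm_diff: "cseminorm p \<Longrightarrow> p (x - y) \<le> p x + p y"
  by (metis cseminorm_minus cseminorm_triangle uminus_add_conv_diff add.commute)

lemma cseminorm_nonneg: "cseminorm p \<Longrightarrow> 0 \<le> p x"
  using cseminorm_diff[of p x x] cseminorm_0[of p] by simp

lemma cseminorm_sum: "cseminorm p \<Longrightarrow> p (sum f A) \<le> (\<Sum>i\<in>A. p (f i))"
proof (induction A rule: infinite_finite_induct)
  case (insert a A)
  then show ?case using cseminorm_triangle[of p "f a" "sum f A"] by simp
qed (auto simp: cseminorm_0)

section \<open>Decay of powers from a lower bound on the resolvent\<close>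

text \<open>For 0 < k < n the number \<open>\<omega> ^ k\<close> is a root of unity other than 1, so
  its geometric sum over a full period cancels. Averaging a polynomial of degree below
  \<open>n\<close> over the rotated arguments thus keeps only the constant coefficient.\<close>

lemma sum_roots_of_unity:
  fixes n k :: nat
  assumes "k < n"
  defines "\<omega> \<equiv> exp (2 * of_real pi * \<i> / of_nat n)"
  shows "(\<Sum>j<n. (\<omega> ^ j) ^ k) = (if k = 0 then of_nat n else 0)"
proof (cases "k = 0")
  case False
  have \<omega>k: "\<omega> ^ k = exp (2 * of_real pi * \<i> * of_nat k / of_nat n)"
    unfolding \<omega>_def by (subst exp_of_nat_mult[symmetric]) (simp add: algebra_simps)
  have "\<omega> ^ k \<noteq> 1"
    unfolding \<omega>k using complex_root_unity_eq_1[of n k] assms(1) False by (auto dest: dvd_imp_le)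
  moreover have "(\<omega> ^ k) ^ n = 1"
    unfolding \<omega>k using complex_root_unity[of n k] assms(1) by simp
  moreover have "(\<Sum>j<n. (\<omega> ^ j) ^ k) = (\<Sum>j<n. (\<omega> ^ k) ^ j)"
    by (simp add: power_mult[symmetric] mult.commute)
  ultimately show ?thesis using False by (simp add: sum_gp_strict)
qed simp

text \<open>\<open>G n z\<close> plays the part of \<open>1 - z^n S^n\<close> divided by
  \<open>1 - z S\<close>, without any invertibility.\<close>

lemma geometric_telescope:
  assumes "clinear S"
  defines "G \<equiv> \<lambda>n z x. \<Sum>k<n. z ^ k *\<^sub>C (S ^^ k) x"
  shows "G n z x - z *\<^sub>C S (G n z x) = x - z ^ n *\<^sub>C (S ^^ n) x"
proof (induction n)
  case 0
  then show ?case by (simp add: G_def clinear_0[OF assms(1)] scaleC_one)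
next
  case (Suc n)
  have "G (Suc n) z x - z *\<^sub>C S (G (Suc n) z x)
      = (G n z x - z *\<^sub>C S (G n z x)) + (z ^ n *\<^sub>C (S ^^ n) x - z ^ Suc n *\<^sub>C (S ^^ Suc n) x)"
    by (simp add: G_def clinear_add[OF assms(1)] clinear_scaleC[OF assms(1)] scaleC_add_right scaleC_scaleC)
  then show ?case using Suc by simp
qed

text \<open>
  Rickart's trick: \<open>1 - b\<^sup>n S\<^sup>n\<close> factors as the product of \<open>1 - b \<omega>\<^sup>j S\<close> over the
  \<open>n\<close>-th roots of unity, and its inverse is the average of the inverses of the factors. The
  lower bound makes this average Lipschitz in \<open>b\<close> uniformly in \<open>n\<close>.
\<close>

lemma powers_small_step:
  fixes S :: "'a::complex_vector \<Rightarrow> 'a"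
  assumes q: "cseminorm q" and S: "clinear S" and qS: "\<And>x. q (S x) \<le> s * q x"
    and c: "0 < c" and low: "\<And>z x. cmod z \<le> 1 \<Longrightarrow> c * q x \<le> q (x - z *\<^sub>C S x)"
    and ab: "0 \<le> a" "a \<le> b" "b \<le> 1" "(b - a) * s \<le> c\<^sup>2 / 16"
    and n: "0 < n" and small: "\<And>x. a ^ n * q ((S ^^ n) x) \<le> q x / 5"
  shows "b ^ n * q ((S ^^ n) x) \<le> q x / 2"
proof -
  define \<omega> where "\<omega> = exp (2 * of_real pi * \<i> / of_nat n)"
  have cmod\<omega>: "cmod \<omega> = 1" and \<omega>n: "\<omega> ^ n = 1"
    using complex_root_unity[of n 1] n by (simp_all add: \<omega>_def)
  define G where "G = (\<lambda>z x. \<Sum>k<n. z ^ k *\<^sub>C (S ^^ k) x)"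
  define A where "A = (\<lambda>z x. x - z *\<^sub>C S x)"
  define P where "P = (\<lambda>r::real. \<lambda>x. of_real r ^ n *\<^sub>C (S ^^ n) x)"
  \<comment> \<open>Rotating \<open>r\<close> by a root of unity does not change its
    \<open>n\<close>-th power, so all \<open>j\<close> share one right-hand side.\<close>
  have AG: "A (of_real r * \<omega> ^ j) (G (of_real r * \<omega> ^ j) x) = x - P r x" for r j x
  proof -
    have "(\<omega> ^ j) ^ n = 1" by (metis \<omega>n power_one power_mult mult.commute)
    then show ?thesis
      using geometric_telescope[OF S, where n = n and z = "of_real r * \<omega> ^ j" and x = x]
      by (simp add: A_def G_def P_def power_mult_distrib)
  qed
  have avg: "(\<Sum>j<n. G (of_real r * \<omega> ^ j) x) = of_nat n *\<^sub>C x" for r x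
  proof -
    have "(\<Sum>j<n. G (of_real r * \<omega> ^ j) x)
        = (\<Sum>k<n. \<Sum>j<n. (of_real r * \<omega> ^ j) ^ k *\<^sub>C (S ^^ k) x)"
      unfolding G_def by (rule sum.swap)
    also have "\<dots> = (\<Sum>k<n. (of_real r ^ k * (\<Sum>j<n. (\<omega> ^ j) ^ k)) *\<^sub>C (S ^^ k) x)"
      by (simp add: complex_vector.scale_sum_left sum_distrib_left power_mult_distrib)
    also have "\<dots> = (\<Sum>k<n. if k = 0 then of_nat n *\<^sub>C x else 0)"
      by (intro sum.cong refl) (auto simp: \<omega>_def sum_roots_of_unity)
    also have "\<dots> = of_nat n *\<^sub>C x" using n by (simp add: sum.delta)
    finally show ?thesis .
  qed
  have P: "clinear (P r)" for r
    unfolding P_def by (intro clinearI)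
      (simp_all add: clinear_add[OF clinear_funpow[OF S]] clinear_scaleC[OF clinear_funpow[OF S]]
        scaleC_add_right scaleC_scaleC mult.commute)
  have qP: "q (P r x) = r ^ n * q ((S ^^ n) x)" if "0 \<le> r" for r x
    using that by (simp add: P_def cseminorm_scaleC[OF q] norm_power)
  have qPa: "q (P a x) \<le> q x / 5" for x using small qP ab by simp
  \<comment> \<open>\<open>x\<close> solves \<open>x - P b x = y\<close>. \<open>v\<close> is a
    truncated Neumann series for the same equation at radius \<open>a\<close>, where
    \<open>P a\<close> contracts by 1/5. Stopping after \<open>m\<close> terms avoids any appeal to
    completeness; the error \<open>e\<close> is a negligible multiple of both \<open>q y\<close> and
    \<open>c * q y\<close>.\<close>
  define y where "y = x - P b x"
  obtain m where m: "(1/5) ^ m < min (1/1000) (c/1000)"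
    using real_arch_pow_inv[of "min (1/1000) (c/1000)" "1/5"] c by auto
  define v where "v = (\<Sum>i<m. (P a ^^ i) y)"
  define e where "e = (1/5) ^ m * q y"
  have pow: "q ((P a ^^ i) y) \<le> (1/5) ^ i * q y" for i
  proof (induction i)
    case (Suc i)
    then show ?case using qPa[of "(P a ^^ i) y"] by simp
  qed simp
  have v: "v - P a v = y - (P a ^^ m) y"
  proof -
    have "(\<Sum>i<m. (P a ^^ i) y) - P a (\<Sum>i<m. (P a ^^ i) y) = y - (P a ^^ m) y" for m
    proof (induction m)
      case (Suc m)
      have "(\<Sum>i<Suc m. (P a ^^ i) y) - P a (\<Sum>i<Suc m. (P a ^^ i) y)
          = ((\<Sum>i<m. (P a ^^ i) y) - P a (\<Sum>i<m. (P a ^^ i) y)) + ((P a ^^ m) y - (P a ^^ Suc m) y)"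
        by (simp add: clinear_add[OF P])
      also have "\<dots> = y - (P a ^^ Suc m) y" unfolding Suc.IH by simp
      finally show ?case .
    qed (simp add: clinear_0[OF P])
    then show ?thesis by (simp add: v_def)
  qed
  have e0: "0 \<le> e" "e \<le> q y / 1000" "e \<le> c * q y / 1000"
  proof -
    have "(1/5) ^ m * q y \<le> r * q y" if "(1/5) ^ m < r" for r :: real
      using that cseminorm_nonneg[OF q] by (intro mult_right_mono) auto
    from this[of "1/1000"] this[of "c/1000"] m show "0 \<le> e" "e \<le> q y / 1000" "e \<le> c * q y / 1000"
      using cseminorm_nonneg[OF q, of y] by (simp_all add: e_def)
  qed
  have y': "q (v - P a v - y) \<le> e"
    unfolding v e_def using pow[of m] by (simp add: cseminorm_minus[OF q])
  have y'2: "q (v - P a v) \<le> q y + e"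
    using cseminorm_triangle[OF q, of "v - P a v - y" y] y' by simp
  \<comment> \<open>Resolvent identity: \<open>A zb (ub - ua)\<close> is the truncation error plus
    \<open>zb - za\<close> times \<open>S ua\<close>. The lower bound enters twice, for
    \<open>ub - ua\<close> and for \<open>ua\<close>, hence the square of \<open>c\<close> in the
    step condition.\<close>
  have each: "q (G (of_real b * \<omega> ^ j) x - G (of_real a * \<omega> ^ j) v) \<le> (e + c / 16 * (q y + e)) / c" for j
  proof -
    define zb za ub ua where "zb = of_real b * \<omega> ^ j" and "za = of_real a * \<omega> ^ j"
      and "ub = G zb x" and "ua = G za v"
    have cz: "cmod zb \<le> 1" "cmod za \<le> 1" "cmod (zb - za) = b - a"
      using ab by (auto simp: zb_def za_def norm_mult norm_power cmod\<omega> simp flip: left_diff_distrib of_real_diff)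
    have Ab: "A zb ub = y" and Aa: "A za ua = v - P a v"
      by (simp_all add: zb_def za_def ub_def ua_def AG y_def)
    have ua: "c * q ua \<le> q y + e"
      using low[OF cz(2), of ua] Aa y'2 by (simp add: A_def)
    have "c * q (ub - ua) \<le> q (A zb (ub - ua))"
      using low[OF cz(1)] by (simp add: A_def)
    also have "A zb (ub - ua) = (y - (v - P a v)) + (zb - za) *\<^sub>C S ua"
      unfolding Ab[symmetric] Aa[symmetric] A_def
      by (simp add: clinear_diff[OF S] complex_vector.scale_right_diff_distrib
          complex_vector.scale_left_diff_distrib)
    also have "q \<dots> \<le> q (y - (v - P a v)) + cmod (zb - za) * q (S ua)"
      using cseminorm_triangle[OF q] by (metis cseminorm_scaleC[OF q])
    also have "\<dots> \<le> e + (b - a) * (s * q ua)"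
      using y' cz(3) qS[of ua] ab by (intro add_mono) (auto simp: cseminorm_minus_commute[OF q, of y] mult_left_mono)
    also have "(b - a) * (s * q ua) \<le> c\<^sup>2 / 16 * q ua"
      using mult_right_mono[OF ab(4) cseminorm_nonneg[OF q, of ua]] by (simp add: mult.assoc)
    also have "c\<^sup>2 / 16 * q ua = c / 16 * (c * q ua)" by (simp add: power2_eq_square)
    also have "\<dots> \<le> c / 16 * (q y + e)" using ua c by (intro mult_left_mono) auto
    finally show ?thesis
      using c by (simp add: field_simps zb_def za_def ub_def ua_def)
  qed
  have "of_nat n *\<^sub>C (x - v) = (\<Sum>j<n. G (of_real b * \<omega> ^ j) x - G (of_real a * \<omega> ^ j) v)"
    by (simp only: sum_subtractf avg complex_vector.scale_right_diff_distrib)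
  then have "real n * q (x - v) = q (\<Sum>j<n. G (of_real b * \<omega> ^ j) x - G (of_real a * \<omega> ^ j) v)"
    using cseminorm_scaleC[OF q, of "of_nat n" "x - v"] by simp
  also have "\<dots> \<le> (\<Sum>j<n. q (G (of_real b * \<omega> ^ j) x - G (of_real a * \<omega> ^ j) v))"
    by (rule cseminorm_sum[OF q])
  also have "\<dots> \<le> (\<Sum>j<n. (e + c / 16 * (q y + e)) / c)"
    by (intro sum_mono each)
  also have "\<dots> = real n * ((e + c / 16 * (q y + e)) / c)" by simp
  finally have "q (x - v) \<le> (e + c / 16 * (q y + e)) / c"
    using n by (simp only: mult_le_cancel_left_pos of_nat_0_less_iff)
  also have "\<dots> = e / c + (q y + e) / 16" using c by (simp add: field_simps)
  also have "e / c \<le> q y / 1000" using e0 c by (simp add: field_simps)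
  finally have xv: "q (x - v) \<le> q y / 1000 + (q y + e) / 16" by simp
  have "q v \<le> q (v - P a v) + q (P a v)" using cseminorm_triangle[OF q, of "v - P a v" "P a v"] by simp
  then have qv: "q v \<le> 5/4 * (q y + e)" using y'2 qPa[of v] by argo
  have "q (v - y) \<le> q (v - P a v - y) + q (P a v)"
    using cseminorm_triangle[OF q, of "v - P a v - y" "P a v"] by simp
  then have vy: "q (v - y) \<le> e + (q y + e) / 4" using y' qPa[of v] qv by argo
  have "q (x - y) \<le> q (x - v) + q (v - y)" using cseminorm_triangle[OF q, of "x - v" "v - y"] by simp
  \<comment> \<open>Up to the truncation error the sum is 1/16 + 1/4 = 5/16. A factor t here bounds
    \<open>q (P b x)\<close> by t / (1 - t) times \<open>q x\<close>, so t may be at most 1/3 to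
    reach 1/2; 10/31 lies in between.\<close>
  then have "q (x - y) \<le> 10 / 31 * q y" using xv vy e0(2) cseminorm_nonneg[OF q, of y] by argo
  then have "q (P b x) \<le> 10 / 31 * q y" by (simp add: y_def)
  moreover have "q y \<le> q x + q (P b x)" unfolding y_def by (rule cseminorm_diff[OF q])
  ultimately have "q (P b x) \<le> q x / 2" using cseminorm_nonneg[OF q, of x] by argo
  then show ?thesis using qP ab by simp
qed

text \<open>The radius grows in steps of \<open>h / 2\<close>. The bound 1/2 at radius
  \<open>a'\<close> improves to 1/5 at the smaller radius \<open>a\<close> for large
  \<open>n\<close>, because \<open>(a / a') ^ n\<close> tends to 0. The preceding lemma then carries
  1/5 at \<open>a\<close> over to 1/2 at \<open>b\<close>.\<close>

lemma powers_eventually_small: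
  fixes S :: "'a::complex_vector \<Rightarrow> 'a"
  assumes q: "cseminorm q" and S: "clinear S" and qS: "\<And>x. q (S x) \<le> s * q x"
    and c: "0 < c" and low: "\<And>z x. cmod z \<le> 1 \<Longrightarrow> c * q x \<le> q (x - z *\<^sub>C S x)"
  shows "\<exists>N>0. \<forall>x. q ((S ^^ N) x) \<le> q x / 2"
proof -
  define h where "h = c\<^sup>2 / (16 * (\<bar>s\<bar> + 1))"
  have h: "0 < h" using c by (simp add: h_def)
  have hs: "r * s \<le> c\<^sup>2 / 16" if "0 \<le> r" "r \<le> h" for r
  proof -
    have "r * s \<le> r * (\<bar>s\<bar> + 1)" using that by (intro mult_left_mono) auto
    also have "\<dots> \<le> h * (\<bar>s\<bar> + 1)" using that by (intro mult_right_mono) auto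
    also have "\<dots> = c\<^sup>2 / 16" by (simp add: h_def field_simps)
    finally show ?thesis .
  qed
  have *: "\<forall>b. 0 \<le> b \<and> b \<le> 1 \<and> b \<le> real k * (h / 2) \<longrightarrow> (\<exists>N. \<forall>n\<ge>N. \<forall>x. b ^ n * q ((S ^^ n) x) \<le> q x / 2)" for k
  proof (induction k)
    case 0
    then show ?case using cseminorm_nonneg[OF q] by (auto intro!: exI[of _ "1::nat"] simp: power_0_left)
  next
    case (Suc k)
    show ?case
    proof (intro allI impI)
      fix b assume b: "0 \<le> b \<and> b \<le> 1 \<and> b \<le> real (Suc k) * (h / 2)"
      \<comment> \<open>Cutting off at 0 covers the start, where \<open>a = 0\<close> and
        \<open>a ^ n\<close> vanishes for positive \<open>n\<close>.\<close>
      define a a' where "a = max 0 (b - h)" and "a' = max 0 (b - h / 2)"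
      have aa': "0 \<le> a" "a \<le> b" "b - a \<le> h" "0 \<le> a'" "a' \<le> 1" "a < a' \<or> a = 0"
        using b h by (auto simp: a_def a'_def max_def)
      have "b - h / 2 \<le> real k * (h / 2)" using b by (simp add: algebra_simps)
      then have "a' \<le> real k * (h / 2)" using h unfolding a'_def by (intro max.boundedI) auto
      then obtain N where N: "\<And>n x. n \<ge> N \<Longrightarrow> a' ^ n * q ((S ^^ n) x) \<le> q x / 2"
        using Suc aa' by metis
      obtain N' where N': "\<And>n x. n \<ge> N' \<Longrightarrow> a ^ n * q ((S ^^ n) x) \<le> q x / 5"
      proof (cases "a = 0")
        case True
        then show ?thesis using that[of 1] cseminorm_nonneg[OF q] by (auto simp: power_0_left)
      next
        case False
        then have a: "0 < a" "a < a'" using aa' by auto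
        obtain M where M: "(a / a') ^ M < 2 / 5" using real_arch_pow_inv[of "2/5" "a / a'"] a by auto
        show ?thesis
        proof (rule that[of "max M N"])
          fix n x assume n: "n \<ge> max M N"
          have "(a / a') ^ n \<le> (a / a') ^ M" using n a by (intro power_decreasing) auto
          then have "(a / a') ^ n \<le> 2 / 5" using M by simp
          then have "(a / a') ^ n * (a' ^ n * q ((S ^^ n) x)) \<le> 2 / 5 * (q x / 2)"
            using N[of n x] n cseminorm_nonneg[OF q] a by (intro mult_mono) auto
          then show "a ^ n * q ((S ^^ n) x) \<le> q x / 5" using a by (simp add: power_divide)
        qed
      qed
      have "b ^ n * q ((S ^^ n) x) \<le> q x / 2" if "n \<ge> max 1 N'" for n x
      proof (rule powers_small_step[OF q S qS c low, where a = a])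
        show "(b - a) * s \<le> c\<^sup>2 / 16" using aa'(2,3) by (intro hs) simp_all
        show "a ^ n * q ((S ^^ n) x) \<le> q x / 5" for x using that by (intro N') simp
        show "0 \<le> a" "a \<le> b" "b \<le> 1" using aa'(1,2) b by blast+
        show "0 < n" using that by simp
      qed
      then show "\<exists>N. \<forall>n\<ge>N. \<forall>x. b ^ n * q ((S ^^ n) x) \<le> q x / 2" by blast
    qed
  qed
  obtain k :: nat where "1 / (h / 2) \<le> real k" using real_arch_simple by blast
  then have "1 \<le> real k * (h / 2)" using h by (simp add: field_simps)
  then have "\<exists>N. \<forall>n\<ge>N. \<forall>x. 1 ^ n * q ((S ^^ n) x) \<le> q x / 2"
    by (intro *[rule_format]) simp
  then obtain N where N: "\<And>n x. n \<ge> N \<Longrightarrow> q ((S ^^ n) x) \<le> q x / 2"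
    unfolding power_one mult_1 by metis
  show ?thesis using N[of "Suc N"] by (intro exI[of _ "Suc N"]) (simp del: funpow.simps)
qed

section \<open>Distance to a subspace\<close>

lemma bounded_bilinear_scaleC:
  "bounded_bilinear ((*\<^sub>C) :: complex \<Rightarrow> 'a::complex_banach \<Rightarrow> 'a)"
  by (rule bounded_bilinear.intro)
    (auto simp: scaleC_add_left scaleC_add_right scaleR_eq_scaleC scaleC_scaleC norm_scaleC
      scaleC_complex_def mult.commute intro!: exI[of _ 1])

lemmas tendsto_scaleC = bounded_bilinear.tendsto[OF bounded_bilinear_scaleC]

lemma bounded_clinearD:
  assumes "bounded_clinear f"
  shows "clinear f" "bounded_linear f"
proof -
  show f: "clinear f" using assms by (simp add: bounded_clinear_def)
  obtain K where K: "\<And>x. norm (f x) \<le> K * norm x"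
    using assms by (auto simp: bounded_clinear_def)
  show "bounded_linear f"
    by (rule bounded_linear_intro[of _ K])
      (use K in \<open>auto simp: clinear_add[OF f] clinear_scaleR[OF f] mult.commute\<close>)
qed

lemma infdist_approx:
  assumes "H \<noteq> {}" "infdist x H < r"
  obtains h where "h \<in> H" "dist x h < r"
  using assms by (auto simp: infdist_notempty cInf_less_iff)

text \<open>This is the quotient norm of X/H pulled back to the whole space.\<close>

lemma cseminorm_infdist:
  fixes H :: "'a::complex_banach set"
  assumes H: "complex_vector.subspace H"
  shows "cseminorm (\<lambda>x. infdist x H)"
  unfolding cseminorm_def
proof (intro conjI allI)
  have ne: "H \<noteq> {}" using complex_vector.subspace_0[OF H] by blast
  fix x y :: 'a
  show "infdist (x + y) H \<le> infdist x H + infdist y H"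
  proof (rule field_le_epsilon)
    fix e :: real assume "0 < e"
    then have e: "infdist z H < infdist z H + e / 2" for z by simp
    obtain a where a: "a \<in> H" "dist x a < infdist x H + e / 2" by (rule infdist_approx[OF ne e])
    obtain b where b: "b \<in> H" "dist y b < infdist y H + e / 2" by (rule infdist_approx[OF ne e])
    have "infdist (x + y) H \<le> dist (x + y) (a + b)"
      using a b by (intro infdist_le complex_vector.subspace_add[OF H])
    also have "\<dots> \<le> dist x a + dist y b" by (rule dist_triangle_add)
    finally show "infdist (x + y) H \<le> infdist x H + infdist y H + e" using a b by simp
  qed
next
  have ne: "H \<noteq> {}" using complex_vector.subspace_0[OF H] by blast
  have le: "infdist (c *\<^sub>C x) H \<le> cmod c * infdist x H" for c x
  proof -
    have "infdist (c *\<^sub>C x) H \<le> cmod c * dist x h" if "h \<in> H" for h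
      using infdist_le[OF complex_vector.subspace_scale[OF H that, of c], of "c *\<^sub>C x"]
      by (simp add: dist_norm norm_scaleC flip: complex_vector.scale_right_diff_distrib)
    then have *: "infdist (c *\<^sub>C x) H / cmod c \<le> infdist x H" if "c \<noteq> 0"
      using that unfolding infdist_notempty[OF ne, of x]
      by (intro cINF_greatest[OF ne]) (auto simp: pos_divide_le_eq mult.commute)
    show ?thesis
    proof (cases "c = 0")
      case True
      then show ?thesis using complex_vector.subspace_0[OF H] by simp
    qed (use * in \<open>simp add: pos_divide_le_eq mult.commute\<close>)
  qed
  fix c :: complex and x :: 'a
  show "infdist (c *\<^sub>C x) H = cmod c * infdist x H"
  proof (cases "c = 0")
    case True
    then show ?thesis using complex_vector.subspace_0[OF H] by simp
  next
    case False
    have "infdist x H \<le> inverse (cmod c) * infdist (c *\<^sub>C x) H"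
      using le[of "inverse c" "c *\<^sub>C x"] False by (simp add: scaleC_scaleC scaleC_one norm_inverse)
    then have "cmod c * infdist x H \<le> infdist (c *\<^sub>C x) H"
      using False by (simp add: field_simps)
    then show ?thesis using le[of c x] by simp
  qed
qed

lemma infdist_le_norm: "complex_vector.subspace H \<Longrightarrow> infdist x H \<le> norm (x::'a::complex_banach)"
  using infdist_le[OF complex_vector.subspace_0, of H x] by simp

lemma infdist_diff_mem:
  fixes H :: "'a::complex_banach set"
  assumes H: "complex_vector.subspace H" and "x - y \<in> H"
  shows "infdist x H = infdist y H"
proof -
  note q = cseminorm_infdist[OF H]
  have "infdist x H \<le> infdist y H + infdist (x - y) H"
    using cseminorm_triangle[OF q, of y "x - y"] by simp
  moreover have "infdist y H \<le> infdist x H + infdist (x - y) H"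
    using cseminorm_diff[OF q, of x "x - y"] by simp
  ultimately show ?thesis using assms by simp
qed

text \<open>A nearest point may fail to exist. The factor 2 leaves room as soon as the distance is
  positive, which closedness guarantees outside \<open>H\<close>.\<close>

lemma near_best_approximation:
  fixes H :: "'a::complex_banach set"
  assumes H: "complex_vector.subspace H" "closed H"
  obtains h where "h \<in> H" "norm (x - h) \<le> 2 * infdist x H"
proof (cases "x \<in> H")
  case True
  then show ?thesis using that[of x] by simp
next
  case False
  have ne: "H \<noteq> {}" using complex_vector.subspace_0[OF H(1)] by blast
  have "0 < infdist x H" using False H ne by (intro infdist_pos_not_in_closed) auto
  then have "infdist x H < 2 * infdist x H" by simp
  then obtain h where "h \<in> H" "dist x h < 2 * infdist x H" by (rule infdist_approx[OF ne])
  then show ?thesis using that[of h] by (simp add: dist_norm)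
qed

text \<open>\<open>F\<close> maps approximants of \<open>x\<close> in \<open>H\<close> to
  approximants of \<open>F x\<close> in \<open>H\<close>; so the operator induced on the quotient
  inherits the bound \<open>K\<close>.\<close>

lemma infdist_image_le:
  fixes F :: "'a::complex_banach \<Rightarrow> 'a"
  assumes F: "clinear F" "\<And>x. norm (F x) \<le> K * norm x" "F ` H \<subseteq> H" and H: "complex_vector.subspace H"
    and K: "0 \<le> K"
  shows "infdist (F x) H \<le> K * infdist x H"
proof (cases "K = 0")
  case True
  then show ?thesis using F(2)[of x] complex_vector.subspace_0[OF H] by simp
next
  case False
  have ne: "H \<noteq> {}" using complex_vector.subspace_0[OF H] by blast
  have "infdist (F x) H \<le> K * dist x h" if "h \<in> H" for h
  proof -
    have "infdist (F x) H \<le> dist (F x) (F h)" using that F(3) by (intro infdist_le) auto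
    also have "\<dots> \<le> K * dist x h" using F(2)[of "x - h"] by (simp add: dist_norm clinear_diff[OF F(1)])
    finally show ?thesis .
  qed
  then have "infdist (F x) H / K \<le> infdist x H"
    using complex_vector.subspace_0[OF H] False K
    unfolding infdist_notempty[OF ne, of x]
    by (intro cINF_greatest[OF ne]) (auto simp: pos_divide_le_eq mult.commute)
  then show ?thesis using False K by (simp add: pos_divide_le_eq mult.commute)
qed

section \<open>Finite-dimensional subspaces\<close>

text \<open>When \<open>v\<close> lies outside the closed span of \<open>B\<close>, its positive
  distance to that span controls the coefficients of \<open>v\<close>. Along a convergent sequence
  these coefficients are therefore Cauchy, and their limit identifies the limit point.\<close>

lemma closed_span_finite:
  fixes B :: "'a::complex_banach set"
  assumes "finite B"
  shows "closed (complex_vector.span B)"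
  using assms
proof (induction B)
  case (insert v B)
  let ?F = "complex_vector.span B"
  have F: "complex_vector.subspace ?F" by (rule complex_vector.subspace_span)
  note q = cseminorm_infdist[OF F]
  show ?case
  proof (cases "v \<in> ?F")
    case True
    then show ?thesis using insert by (simp add: complex_vector.span_redundant)
  next
    case False
    have d: "0 < infdist v ?F"
      using False insert.IH complex_vector.span_zero[of B] by (intro infdist_pos_not_in_closed) auto
    show ?thesis
      unfolding closed_sequential_limits
    proof (intro allI impI, elim conjE)
      fix z y assume z: "\<forall>n. z n \<in> complex_vector.span (insert v B)" and zy: "z \<longlonglongrightarrow> y"
      obtain k where k: "\<And>n. z n - k n *\<^sub>C v \<in> ?F"
        using z unfolding complex_vector.span_breakdown_eq by metis
      have le: "cmod (k m - k n) * infdist v ?F \<le> dist (z m) (z n)" for m n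
      proof -
        have "cmod (k m - k n) * infdist v ?F = infdist ((k m - k n) *\<^sub>C v) ?F"
          by (simp add: cseminorm_scaleC[OF q])
        also have "\<dots> = infdist (z m - z n) ?F"
        proof (rule sym, rule infdist_diff_mem[OF F])
          show "z m - z n - (k m - k n) *\<^sub>C v \<in> ?F"
            using complex_vector.subspace_diff[OF F k[of m] k[of n]]
            by (simp add: complex_vector.scale_left_diff_distrib algebra_simps)
        qed
        also have "\<dots> \<le> dist (z m) (z n)" using infdist_le_norm[OF F] by (simp add: dist_norm)
        finally show ?thesis .
      qed
      have "Cauchy k"
      proof (rule metric_CauchyI)
        fix e :: real assume "0 < e"
        then obtain M where "\<And>m n. m \<ge> M \<Longrightarrow> n \<ge> M \<Longrightarrow> dist (z m) (z n) < e * infdist v ?F"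
          using metric_CauchyD[OF LIMSEQ_imp_Cauchy[OF zy], of "e * infdist v ?F"] d by auto
        then have "cmod (k m - k n) * infdist v ?F < e * infdist v ?F" if "m \<ge> M" "n \<ge> M" for m n
          using le[of m n] that by (meson order_le_less_trans)
        then show "\<exists>M. \<forall>m\<ge>M. \<forall>n\<ge>M. dist (k m) (k n) < e"
          using d by (auto simp: dist_norm)
      qed
      then obtain l where l: "k \<longlonglongrightarrow> l" using Cauchy_convergent convergent_def by blast
      have lim: "(\<lambda>n. z n - k n *\<^sub>C v) \<longlonglongrightarrow> y - l *\<^sub>C v"
        by (intro tendsto_intros tendsto_scaleC zy l)
      have "y - l *\<^sub>C v \<in> ?F" using k by (intro closed_sequentially[OF insert.IH _ lim]) simp
      then show "y \<in> complex_vector.span (insert v B)" using complex_vector.span_breakdown_eq by blast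
    qed
  qed
qed simp

lemma closed_subspace_of_span_finite:
  fixes B :: "'a::complex_banach set"
  assumes "finite B" "complex_vector.subspace D" "D \<subseteq> complex_vector.span B"
  shows "closed D"
proof -
  obtain A where A: "A \<subseteq> D" "complex_vector.independent A" "D \<subseteq> complex_vector.span A"
    by (rule complex_vector.basis_exists)
  have "finite A" using complex_vector.independent_span_bound[OF assms(1) A(2)] A(1) assms(3) by blast
  moreover have "complex_vector.span A = D"
    using A assms(2) by (simp add: complex_vector.span_minimal subset_antisym)
  ultimately show ?thesis using closed_span_finite by blast
qed

section \<open>Unstable generalized eigenvectors of a compact operator\<close>

lemma compact_operatorD:
  assumes "compact_operator S"
  shows "clinear S" "bounded_linear S"
    and "bounded (range x) \<Longrightarrow> \<exists>y r. strict_mono (r :: nat \<Rightarrow> nat) \<and> (\<lambda>n. S (x (r n))) \<longlonglongrightarrow> y"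
proof -
  show "clinear S" "bounded_linear S"
    using assms bounded_clinearD by (auto simp: compact_operator_def)
  assume "bounded (range x)"
  then have "compact (closure (S ` range x))" using assms by (auto simp: compact_operator_def)
  moreover have "\<forall>n. S (x n) \<in> closure (S ` range x)" using closure_subset by fastforce
  ultimately show "\<exists>y r. strict_mono r \<and> (\<lambda>n. S (x (r n))) \<longlonglongrightarrow> y"
    by (rule seq_compactE[OF compact_imp_seq_compact]) (auto simp: o_def)
qed

text \<open>
  Riesz' argument: unit vectors of \<open>W (n + 1)\<close> far from \<open>W n\<close> have images
  that stay apart.
\<close>

lemma compact_no_infinite_chain:
  fixes S :: "'a::complex_banach \<Rightarrow> 'a"
  assumes S: "compact_operator S"
    and W: "\<And>n. complex_vector.subspace (W n)" "\<And>n. closed (W n)" "\<And>n. W n \<subseteq> W (Suc n)"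
      "\<And>n. S ` W n \<subseteq> W n"
    and v: "\<And>n. v n \<in> W (Suc n)" "\<And>n. v n \<notin> W n" "\<And>n. S (v n) - \<mu> n *\<^sub>C v n \<in> W n"
    and \<mu>: "\<And>n. 1 \<le> cmod (\<mu> n)"
  shows False
proof -
  note lin = compact_operatorD(1)[OF S]
  note q = cseminorm_infdist[OF W(1)]
  have pos: "0 < infdist (v n) (W n)" for n
    using v(2) W(2) complex_vector.subspace_0[OF W(1), of n] by (intro infdist_pos_not_in_closed) blast+
  have "\<exists>w. w \<in> W n \<and> norm (v n - w) \<le> 2 * infdist (v n) (W n)" for n
    by (rule near_best_approximation[OF W(1,2)]) blast
  then obtain w where w: "\<And>n. w n \<in> W n" "\<And>n. norm (v n - w n) \<le> 2 * infdist (v n) (W n)"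
    by metis
  define N where "N = (\<lambda>n. norm (v n - w n))"
  have N: "0 < N n" for n
    using v(2)[of n] w(1)[of n] by (auto simp: N_def)
  define y where "y = (\<lambda>n. of_real (1 / N n) *\<^sub>C (v n - w n))"
  have ny: "norm (y n) = 1" for n
    using N[of n] by (simp add: y_def norm_scaleC norm_divide) (simp add: N_def)
  have dy: "1 / 2 \<le> infdist (y n) (W n)" for n
  proof -
    have "infdist (v n - w n) (W n) = infdist (v n) (W n)"
      by (rule infdist_diff_mem[OF W(1)]) (simp add: complex_vector.subspace_neg[OF W(1)] w)
    then show ?thesis
      using N[of n] w(2)[of n] 
      by (simp add: y_def cseminorm_scaleC[OF q] norm_divide pos_le_divide_eq) (simp add: N_def)
  qed
  have yW: "y n \<in> W (Suc n)" for n
    unfolding y_def using v(1) w(1) W(3)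
    by (intro complex_vector.subspace_scale[OF W(1)] complex_vector.subspace_diff[OF W(1)]) auto
  have Sy: "S (y n) - \<mu> n *\<^sub>C y n \<in> W n" for n
  proof -
    have "S (y n) - \<mu> n *\<^sub>C y n
      = of_real (1 / N n) *\<^sub>C ((S (v n) - \<mu> n *\<^sub>C v n) - (S (w n) - \<mu> n *\<^sub>C w n))"
      by (simp add: y_def clinear_scaleC[OF lin] clinear_diff[OF lin] scaleC_scaleC
          complex_vector.scale_right_diff_distrib mult.commute)
    moreover have "S (w n) \<in> W n" using W(4) w(1) by blast
    ultimately show ?thesis
      using v(3)[of n] w(1)[of n] by (auto intro!: complex_vector.subspace_scale[OF W(1)] complex_vector.subspace_diff[OF W(1)])
  qed
  \<comment> \<open>\<open>S (y m)\<close> already lies in \<open>W n\<close>, so modulo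
    \<open>W n\<close> the difference is \<open>\<mu> n *\<^sub>C y n\<close>, whose distance to
    \<open>W n\<close> is at least 1/2.\<close>
  have sep: "1 / 2 \<le> dist (S (y n)) (S (y m))" if "m < n" for m n
  proof -
    have "W (Suc m) \<subseteq> W n" using that by (intro lift_Suc_mono_le[of W, OF W(3)]) simp
    then have "S (y m) \<in> W n" using yW[of m] W(4) by blast
    then have "\<mu> n *\<^sub>C y n - (S (y n) - S (y m)) \<in> W n"
      using complex_vector.subspace_diff[OF W(1) _ Sy[of n], of "S (y m)"] by (simp add: algebra_simps)
    then have "infdist (\<mu> n *\<^sub>C y n) (W n) = infdist (S (y n) - S (y m)) (W n)"
      by (rule infdist_diff_mem[OF W(1)])
    moreover have "1 * (1 / 2) \<le> cmod (\<mu> n) * infdist (y n) (W n)"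
      using \<mu> dy by (intro mult_mono) auto
    ultimately show ?thesis
      using infdist_le_norm[OF W(1), of "S (y n) - S (y m)" n] by (simp add: dist_norm cseminorm_scaleC[OF q])
  qed
  have "bounded (range y)" using ny by (auto simp: bounded_iff intro!: exI[of _ 1])
  then obtain l r where r: "strict_mono (r :: nat \<Rightarrow> nat)" "(\<lambda>n. S (y (r n))) \<longlonglongrightarrow> l"
    using compact_operatorD(3)[OF S] by blast
  then obtain M where "\<And>m n. m \<ge> M \<Longrightarrow> n \<ge> M \<Longrightarrow> dist (S (y (r m))) (S (y (r n))) < 1 / 2"
    using metric_CauchyD[OF LIMSEQ_imp_Cauchy[OF r(2)], of "1/2"] by auto
  from this[of "Suc M" M] sep[of "r M" "r (Suc M)"] r(1) show False
    by (simp add: strict_mono_Suc_iff)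
qed

section \<open>The unstable space \<open>H\<close>: finite dimension, and eigenvalues modulo
  it\<close>

definition unstable_space :: "('a::complex_vector \<Rightarrow> 'a) \<Rightarrow> 'a set" where
  "unstable_space S = complex_vector.span (\<Union>\<mu>\<in>{\<mu>. 1 \<le> cmod \<mu>}. generalized_eigenvectors S \<mu>)"

lemma subspace_unstable_space: "complex_vector.subspace (unstable_space S)"
  unfolding unstable_space_def by (rule complex_vector.subspace_span)

lemma generalized_eigenvectors_iff:
  "v \<in> generalized_eigenvectors S \<mu> \<longleftrightarrow> (\<exists>k. ((\<lambda>w. \<mu> *\<^sub>C w - S w) ^^ k) v = 0)"
  by (simp add: generalized_eigenvectors_def)

lemma funpow_eq_0_mono:
  fixes F :: "'a::complex_vector \<Rightarrow> 'a"
  assumes "clinear F" "(F ^^ k) v = 0" "k \<le> m"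
  shows "(F ^^ m) v = 0"
  using assms clinear_0[OF clinear_funpow[OF assms(1)]]
  by (metis add_diff_inverse_nat comp_apply funpow_add add.commute le_add_diff_inverse2)

lemma generalized_eigenvectors_subset_unstable_space:
  "1 \<le> cmod \<mu> \<Longrightarrow> generalized_eigenvectors S \<mu> \<subseteq> unstable_space S"
  unfolding unstable_space_def by (rule order_trans[OF _ complex_vector.span_superset]) auto

lemma subspace_generalized_eigenvectors:
  assumes "clinear S"
  shows "complex_vector.subspace (generalized_eigenvectors S \<mu>)"
proof (rule complex_vector.subspaceI)
  note T = clinear_scaleC_minus[OF assms, of \<mu>]
  note Tk = clinear_funpow[OF T]
  show "0 \<in> generalized_eigenvectors S \<mu>"
    by (simp add: generalized_eigenvectors_iff clinear_0[OF Tk])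
  show "c *\<^sub>C x \<in> generalized_eigenvectors S \<mu>" if "x \<in> generalized_eigenvectors S \<mu>" for c x
    using that by (auto simp: generalized_eigenvectors_iff clinear_scaleC[OF Tk])
  show "x + y \<in> generalized_eigenvectors S \<mu>"
    if xy: "x \<in> generalized_eigenvectors S \<mu>" "y \<in> generalized_eigenvectors S \<mu>" for x y
  proof -
    obtain j k where "((\<lambda>w. \<mu> *\<^sub>C w - S w) ^^ j) x = 0" "((\<lambda>w. \<mu> *\<^sub>C w - S w) ^^ k) y = 0"
      using xy unfolding generalized_eigenvectors_iff by blast
    then have "((\<lambda>w. \<mu> *\<^sub>C w - S w) ^^ (max j k)) (x + y) = 0"
      using funpow_eq_0_mono[OF T, of j x "max j k"] funpow_eq_0_mono[OF T, of k y "max j k"]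
      by (simp add: clinear_add[OF Tk])
    then show ?thesis by (auto simp: generalized_eigenvectors_iff)
  qed
qed

text \<open>Otherwise finite-dimensional invariant subspaces of \<open>H\<close> could be enlarged
  forever, one vector at a time, each new vector being an eigenvector modulo the current subspace.
  Such a chain was excluded by Riesz' argument.\<close>

lemma unstable_space_finite_dim:
  fixes S :: "'a::complex_banach \<Rightarrow> 'a"
  assumes S: "compact_operator S"
  shows "\<exists>B. finite B \<and> complex_vector.span B = unstable_space S"
proof (rule ccontr)
  note lin = compact_operatorD(1)[OF S]
  let ?H = "unstable_space S"
  assume none: "\<not> ?thesis"
  define P where "P = (\<lambda>(n::nat) B. finite B \<and> B \<subseteq> ?H \<and> S ` complex_vector.span B \<subseteq> complex_vector.span B)"
  define Q where "Q = (\<lambda>(n::nat) B B'. \<exists>v \<mu>. B' = insert v B \<and> v \<notin> complex_vector.span B \<and> 1 \<le> cmod \<mu> \<and>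
      S v - \<mu> *\<^sub>C v \<in> complex_vector.span B)"
  have "\<exists>B'. P (Suc n) B' \<and> Q n B B'" if "P n B" for n B
  proof -
    let ?F = "complex_vector.span B"
    have B: "finite B" "B \<subseteq> ?H" "S ` ?F \<subseteq> ?F" using that by (auto simp: P_def)
    have "?F \<subseteq> ?H" using B(2) complex_vector.span_minimal subspace_unstable_space by blast
    then have "\<not> ?H \<subseteq> ?F" using none B(1) by blast
    then obtain w \<mu> where w: "1 \<le> cmod \<mu>" "w \<in> generalized_eigenvectors S \<mu>" "w \<notin> ?F"
      unfolding unstable_space_def
      by (metis (mono_tags, lifting) UN_E complex_vector.span_minimal complex_vector.subspace_span mem_Collect_eq subsetI)
    let ?T = "\<lambda>w. \<mu> *\<^sub>C w - S w"
    note T = clinear_scaleC_minus[OF lin, of \<mu>]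
    obtain k where k: "(?T ^^ k) w = 0" using w(2) by (auto simp: generalized_eigenvectors_iff)
    \<comment> \<open>Powers of \<open>\<mu> - S\<close> eventually move \<open>w\<close> into the
      current span, at the latest when they annihilate it. The last iterate outside the span is an
      eigenvector modulo the span.\<close>
    define j where "j = (LEAST j. (?T ^^ j) w \<in> ?F)"
    have j: "(?T ^^ j) w \<in> ?F" "\<And>i. i < j \<Longrightarrow> (?T ^^ i) w \<notin> ?F"
      unfolding j_def using k complex_vector.span_zero[of B]
      by (metis (no_types, lifting) LeastI) (metis (no_types, lifting) not_less_Least)
    have "j \<noteq> 0" using j(1) w(3) by (metis funpow_0)
    then obtain i where i: "j = Suc i" by (cases j) auto
    define v where "v = (?T ^^ i) w"
    have v: "v \<notin> ?F" "?T v \<in> ?F" using j i by (auto simp: v_def)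
    have "(?T ^^ k) v = 0"
      unfolding v_def using k clinear_0[OF clinear_funpow[OF T]] by (metis comp_apply funpow_add add.commute)
    then have vH: "v \<in> ?H"
      using generalized_eigenvectors_subset_unstable_space[OF w(1)] generalized_eigenvectors_iff by blast
    have Sv: "S v - \<mu> *\<^sub>C v \<in> ?F" using complex_vector.span_neg[OF v(2)] by simp
    have "S x \<in> complex_vector.span (insert v B)" if x: "x \<in> complex_vector.span (insert v B)" for x
    proof -
      let ?G = "complex_vector.span (insert v B)"
      have FG: "?F \<subseteq> ?G" by (intro complex_vector.span_mono) auto
      obtain c where c: "x - c *\<^sub>C v \<in> ?F" using x unfolding complex_vector.span_breakdown_eq by blast
      have "S x = S (x - c *\<^sub>C v) + c *\<^sub>C ((S v - \<mu> *\<^sub>C v) + \<mu> *\<^sub>C v)"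
        by (simp add: clinear_diff[OF lin] clinear_scaleC[OF lin])
      also have "\<dots> \<in> ?G"
        using c B(3) Sv FG complex_vector.span_base[of v "insert v B"]
        by (intro complex_vector.span_add complex_vector.span_scale) auto
      finally show ?thesis .
    qed
    then show ?thesis
      using B vH v(1) Sv w(1) by (intro exI[of _ "insert v B"]) (auto simp: P_def Q_def)
  qed
  moreover have "P 0 {}" by (simp add: P_def clinear_0[OF lin])
  ultimately obtain B where B: "\<And>n. P n (B n)" "\<And>n. Q n (B n) (B (Suc n))"
    using dependent_nat_choice[of P Q] by metis
  obtain v \<mu> where v: "\<And>n. B (Suc n) = insert (v n) (B n)" "\<And>n. v n \<notin> complex_vector.span (B n)"
    "\<And>n. 1 \<le> cmod (\<mu> n)" "\<And>n. S (v n) - \<mu> n *\<^sub>C v n \<in> complex_vector.span (B n)"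
    using B(2) unfolding Q_def by metis
  show False
  proof (rule compact_no_infinite_chain[OF S, of "\<lambda>n. complex_vector.span (B n)" v \<mu>])
    show "complex_vector.span (B n) \<subseteq> complex_vector.span (B (Suc n))" for n
      unfolding v(1) by (intro complex_vector.span_mono) auto
    show "v n \<in> complex_vector.span (B (Suc n))" for n
      unfolding v(1) by (intro complex_vector.span_base) auto
  qed (use B(1) v in \<open>auto simp: P_def closed_span_finite complex_vector.subspace_span\<close>)
qed

text \<open>On the kernel of the \<open>k\<close>-th power of \<open>\<nu> - S\<close>, the operator
  \<open>\<mu> - S\<close> is the nonzero scalar \<open>\<mu> - \<nu>\<close> plus the nilpotent
  \<open>\<nu> - S\<close>, hence invertible. The induction on \<open>k\<close> unrolls the finite
  Neumann series.\<close>

lemma solve_on_generalized_eigenvectors: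
  assumes S: "clinear S" and "\<nu> \<noteq> \<mu>" and "((\<lambda>w. \<nu> *\<^sub>C w - S w) ^^ k) w = 0"
  shows "\<exists>z. ((\<lambda>w. \<nu> *\<^sub>C w - S w) ^^ k) z = 0 \<and> \<mu> *\<^sub>C z - S z = w"
  using assms(3)
proof (induction k arbitrary: w)
  case 0
  then show ?case by (intro exI[of _ 0]) (simp add: clinear_0[OF S])
next
  case (Suc k)
  let ?T = "\<lambda>w. \<nu> *\<^sub>C w - S w"
  note T = clinear_scaleC_minus[OF S, of \<nu>]
  have "(?T ^^ k) (?T w) = 0" using Suc.prems by (simp add: funpow_Suc_right del: funpow.simps)
  then obtain z where z: "(?T ^^ k) z = 0" "\<mu> *\<^sub>C z - S z = ?T w" using Suc.IH by blast
  define z' where "z' = inverse (\<mu> - \<nu>) *\<^sub>C (w - z)"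
  have "(?T ^^ Suc k) z = 0" using funpow_eq_0_mono[OF T z(1), of "Suc k"] by simp
  then have "(?T ^^ Suc k) z' = 0"
    using Suc.prems clinear_scaleC[OF clinear_funpow[OF T, of "Suc k"]] clinear_diff[OF clinear_funpow[OF T, of "Suc k"]]
    by (simp add: z'_def del: funpow.simps)
  moreover have "\<mu> *\<^sub>C z' - S z' = w"
  proof -
    have "\<mu> *\<^sub>C z' - S z' = inverse (\<mu> - \<nu>) *\<^sub>C ((\<mu> *\<^sub>C w - S w) - (\<mu> *\<^sub>C z - S z))"
      by (simp add: z'_def clinear_scaleC[OF S] clinear_diff[OF S] complex_vector.scale_right_diff_distrib
          scaleC_scaleC mult.commute)
    also have "\<dots> = inverse (\<mu> - \<nu>) *\<^sub>C ((\<mu> - \<nu>) *\<^sub>C w)"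
      unfolding z(2) by (simp add: complex_vector.scale_left_diff_distrib)
    also have "\<dots> = w" using assms(2) by (simp add: scaleC_scaleC scaleC_one)
    finally show ?thesis .
  qed
  ultimately show ?case by blast
qed

text \<open>Inside \<open>H\<close>, only generalized eigenvectors for \<open>\<mu>\<close> itself
  obstruct solving with \<open>\<mu> - S\<close>. Generators for another \<open>\<nu>\<close> are
  covered by the preceding lemma, and those for \<open>\<mu>\<close> by
  \<open>z = 0\<close>.\<close>

lemma unstable_space_solve:
  assumes S: "clinear S" and \<mu>: "1 \<le> cmod \<mu>" and w: "w \<in> unstable_space S"
  shows "\<exists>z\<in>unstable_space S. w - (\<mu> *\<^sub>C z - S z) \<in> generalized_eigenvectors S \<mu>"
  using w unfolding unstable_space_def
proof (induction rule: complex_vector.span_induct)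
  note T = clinear_scaleC_minus[OF S, of \<mu>]
  note E = subspace_generalized_eigenvectors[OF S, of \<mu>]
  case base
  show ?case
  proof (rule complex_vector.subspaceI; clarify)
    show "\<exists>z\<in>complex_vector.span (\<Union>\<mu>\<in>{\<mu>. 1 \<le> cmod \<mu>}. generalized_eigenvectors S \<mu>).
      0 - (\<mu> *\<^sub>C z - S z) \<in> generalized_eigenvectors S \<mu>"
      using complex_vector.subspace_0[OF E] by (intro bexI[of _ 0]) (auto simp: clinear_0[OF S] complex_vector.span_zero)
  next
    fix x y z z'
    assume *: "z \<in> complex_vector.span (\<Union>\<mu>\<in>{\<mu>. 1 \<le> cmod \<mu>}. generalized_eigenvectors S \<mu>)"
      "x - (\<mu> *\<^sub>C z - S z) \<in> generalized_eigenvectors S \<mu>"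
      "z' \<in> complex_vector.span (\<Union>\<mu>\<in>{\<mu>. 1 \<le> cmod \<mu>}. generalized_eigenvectors S \<mu>)"
      "y - (\<mu> *\<^sub>C z' - S z') \<in> generalized_eigenvectors S \<mu>"
    have "x + y - (\<mu> *\<^sub>C (z + z') - S (z + z')) = (x - (\<mu> *\<^sub>C z - S z)) + (y - (\<mu> *\<^sub>C z' - S z'))"
      by (simp add: clinear_add[OF T])
    then show "\<exists>z\<in>complex_vector.span (\<Union>\<mu>\<in>{\<mu>. 1 \<le> cmod \<mu>}. generalized_eigenvectors S \<mu>).
      x + y - (\<mu> *\<^sub>C z - S z) \<in> generalized_eigenvectors S \<mu>"
      using * complex_vector.subspace_add[OF E] complex_vector.span_add by (metis (no_types, lifting))
  next
    fix c x z
    assume *: "z \<in> complex_vector.span (\<Union>\<mu>\<in>{\<mu>. 1 \<le> cmod \<mu>}. generalized_eigenvectors S \<mu>)"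
      "x - (\<mu> *\<^sub>C z - S z) \<in> generalized_eigenvectors S \<mu>"
    have "c *\<^sub>C x - (\<mu> *\<^sub>C (c *\<^sub>C z) - S (c *\<^sub>C z)) = c *\<^sub>C (x - (\<mu> *\<^sub>C z - S z))"
      by (simp add: clinear_scaleC[OF S] scaleC_scaleC mult.commute complex_vector.scale_right_diff_distrib)
    then show "\<exists>z\<in>complex_vector.span (\<Union>\<mu>\<in>{\<mu>. 1 \<le> cmod \<mu>}. generalized_eigenvectors S \<mu>).
      c *\<^sub>C x - (\<mu> *\<^sub>C z - S z) \<in> generalized_eigenvectors S \<mu>"
      using * complex_vector.subspace_scale[OF E] complex_vector.span_scale by (metis (no_types, lifting))
  qed
next
  note E = subspace_generalized_eigenvectors[OF S, of \<mu>]
  case (step w)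
  then obtain \<nu> where \<nu>: "1 \<le> cmod \<nu>" "w \<in> generalized_eigenvectors S \<nu>" by auto
  show ?case
  proof (cases "\<nu> = \<mu>")
    case True
    then show ?thesis using \<nu> by (intro bexI[of _ 0]) (auto simp: clinear_0[OF S] complex_vector.span_zero)
  next
    case False
    then obtain z where "z \<in> generalized_eigenvectors S \<nu>" "\<mu> *\<^sub>C z - S z = w"
      using \<nu>(2) solve_on_generalized_eigenvectors[OF S False] by (auto simp: generalized_eigenvectors_iff) blast
    then show ?thesis
      using \<nu>(1) complex_vector.subspace_0[OF E]
      by (intro bexI[of _ z] complex_vector.span_base) auto
  qed
qed

text \<open>Passing to the quotient by \<open>H\<close> could a priori create new eigenvectors.
  Subtracting a suitable \<open>z\<close> in \<open>H\<close> from \<open>v\<close> makes the image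
  under \<open>\<mu> - S\<close> a generalized eigenvector for \<open>\<mu>\<close>; then
  \<open>v - z\<close> is one as well and lies in \<open>H\<close>.\<close>

lemma unstable_space_no_more_eigenvectors:
  assumes S: "clinear S" and \<mu>: "1 \<le> cmod \<mu>" and v: "\<mu> *\<^sub>C v - S v \<in> unstable_space S"
  shows "v \<in> unstable_space S"
proof -
  note T = clinear_scaleC_minus[OF S, of \<mu>]
  obtain z where z: "z \<in> unstable_space S" "\<mu> *\<^sub>C v - S v - (\<mu> *\<^sub>C z - S z) \<in> generalized_eigenvectors S \<mu>"
    using unstable_space_solve[OF S \<mu> v] by blast
  then obtain k where "((\<lambda>w. \<mu> *\<^sub>C w - S w) ^^ k) (\<mu> *\<^sub>C (v - z) - S (v - z)) = 0"
    by (auto simp: generalized_eigenvectors_iff clinear_diff[OF T])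
  then have "((\<lambda>w. \<mu> *\<^sub>C w - S w) ^^ Suc k) (v - z) = 0" by (simp add: funpow_Suc_right del: funpow.simps)
  then have "v - z \<in> unstable_space S"
    using generalized_eigenvectors_subset_unstable_space[OF \<mu>, of S] generalized_eigenvectors_iff by blast
  then show ?thesis using complex_vector.subspace_add[OF subspace_unstable_space z(1), of "v - z"] by simp
qed

text \<open>Used both for \<open>S\<close> itself and for all \<open>\<Phi> t\<close>, which commute
  with \<open>\<Phi> 1\<close>.\<close>

lemma unstable_space_invariant:
  assumes F: "clinear F" and comm: "\<And>x. F (S x) = S (F x)"
  shows "F ` unstable_space S \<subseteq> unstable_space S"
    and "F ` generalized_eigenvectors S \<mu> \<subseteq> generalized_eigenvectors S \<mu>"
proof -
  have gen: "F v \<in> generalized_eigenvectors S \<mu>" if "v \<in> generalized_eigenvectors S \<mu>" for v \<mu>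
  proof -
    have *: "((\<lambda>w. \<mu> *\<^sub>C w - S w) ^^ k) (F x) = F (((\<lambda>w. \<mu> *\<^sub>C w - S w) ^^ k) x)" for k x
      by (induction k) (simp_all add: clinear_diff[OF F] clinear_scaleC[OF F] comm)
    show ?thesis using that clinear_0[OF F] unfolding generalized_eigenvectors_iff * by metis
  qed
  then show "F ` generalized_eigenvectors S \<mu> \<subseteq> generalized_eigenvectors S \<mu>" by blast
  have "F x \<in> unstable_space S" if "x \<in> unstable_space S" for x
    using that unfolding unstable_space_def
  proof (induction rule: complex_vector.span_induct)
    case base
    show ?case
      by (rule complex_vector.subspaceI)
        (auto simp: clinear_0[OF F] clinear_add[OF F] clinear_scaleC[OF F] complex_vector.span_zero
          complex_vector.span_add complex_vector.span_scale)
  next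
    case (step x)
    then show ?case using gen by (auto intro!: complex_vector.span_base)
  qed
  then show "F ` unstable_space S \<subseteq> unstable_space S" by blast
qed

text \<open>If no \<open>c\<close> works, there are points at distance 1 from \<open>H\<close> with
  \<open>x - z *\<^sub>C S x\<close> almost in \<open>H\<close>. Along a subsequence
  \<open>z\<close> tends to some \<open>\<zeta>\<close> and \<open>S x\<close> to some
  \<open>y\<close>, so \<open>x\<close> approaches \<open>\<zeta> *\<^sub>C y\<close> modulo
  \<open>H\<close>. Applying \<open>S\<close> puts \<open>y - \<zeta> *\<^sub>C S y\<close> into
  \<open>H\<close>, whence \<open>y\<close> lies in \<open>H\<close> by \<open>inj\<close>, against
  the distance 1.\<close>

lemma resolvent_lower_bound:
  fixes S :: "'a::complex_banach \<Rightarrow> 'a"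
  assumes S: "compact_operator S" and H: "complex_vector.subspace H" "closed H" "S ` H \<subseteq> H"
    and inj: "\<And>z x. cmod z \<le> 1 \<Longrightarrow> x - z *\<^sub>C S x \<in> H \<Longrightarrow> x \<in> H"
  shows "\<exists>c>0. \<forall>z x. cmod z \<le> 1 \<longrightarrow> c * infdist x H \<le> infdist (x - z *\<^sub>C S x) H"
proof (rule ccontr)
  let ?q = "\<lambda>x. infdist x H"
  note lin = compact_operatorD(1)[OF S]
  note q = cseminorm_infdist[OF H(1)]
  have ne: "H \<noteq> {}" using complex_vector.subspace_0[OF H(1)] by blast
  assume "\<not> ?thesis"
  then have bad: "\<exists>z x. cmod z \<le> 1 \<and> ?q (x - z *\<^sub>C S x) < c * ?q x" if "c > 0" for c
    using that by (auto simp: not_le)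
  have "\<exists>z x. cmod z \<le> 1 \<and> ?q (x - z *\<^sub>C S x) < 1 / real (Suc n) * ?q x" for n
    by (rule bad) simp
  then obtain z x' where zx: "\<And>n. cmod (z n) \<le> 1"
    "\<And>n. ?q (x' n - z n *\<^sub>C S (x' n)) < 1 / real (Suc n) * ?q (x' n)"
    by metis
  have pos: "0 < ?q (x' n)" for n
    using zx(2)[of n] infdist_nonneg[of "x' n - z n *\<^sub>C S (x' n)" H] by (cases "?q (x' n) = 0") (auto simp: order_less_le infdist_nonneg)
  define x'' where "x'' = (\<lambda>n. of_real (1 / ?q (x' n)) *\<^sub>C x' n)"
  have x'': "?q (x'' n) = 1" for n
    using pos[of n] by (simp add: x''_def cseminorm_scaleC[OF q] norm_divide infdist_nonneg)
  have x''2: "?q (x'' n - z n *\<^sub>C S (x'' n)) < 1 / real (Suc n)" for n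
  proof -
    have "x'' n - z n *\<^sub>C S (x'' n) = of_real (1 / ?q (x' n)) *\<^sub>C (x' n - z n *\<^sub>C S (x' n))"
      by (simp add: x''_def clinear_scaleC[OF lin] scaleC_scaleC complex_vector.scale_right_diff_distrib mult.commute)
    then have "?q (x'' n - z n *\<^sub>C S (x'' n)) = ?q (x' n - z n *\<^sub>C S (x' n)) / ?q (x' n)"
      using pos[of n] by (simp add: cseminorm_scaleC[OF q] norm_divide infdist_nonneg)
    moreover have "?q (x' n - z n *\<^sub>C S (x' n)) / ?q (x' n) < 1 / real (Suc n)"
      unfolding pos_divide_less_eq[OF pos[of n]] by (rule zx(2))
    ultimately show ?thesis by simp
  qed
  \<comment> \<open>Normalizing fixes only the distance to \<open>H\<close>. Compactness of
    \<open>S\<close> needs a norm bound, obtained by subtracting elements of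
    \<open>H\<close>.\<close>
  have "\<exists>h. h \<in> H \<and> norm (x'' n - h) \<le> 2" for n
    by (rule near_best_approximation[OF H(1,2), of "x'' n"]) (use x'' in auto)
  then obtain h where h: "\<And>n. h n \<in> H" "\<And>n. norm (x'' n - h n) \<le> 2" by metis
  define x where "x = (\<lambda>n. x'' n - h n)"
  have qx: "?q (x n) = 1" for n
    using infdist_diff_mem[OF H(1), of "x n" "x'' n"] complex_vector.subspace_neg[OF H(1) h(1)] x'' by (simp add: x_def)
  have qx2: "?q (x n - z n *\<^sub>C S (x n)) < 1 / real (Suc n)" for n
  proof -
    have "(x n - z n *\<^sub>C S (x n)) - (x'' n - z n *\<^sub>C S (x'' n)) = z n *\<^sub>C S (h n) - h n"
      by (simp add: x_def clinear_diff[OF lin] complex_vector.scale_right_diff_distrib)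
    also have "\<dots> \<in> H"
      using h(1)[of n] H(3) by (intro complex_vector.subspace_diff[OF H(1)] complex_vector.subspace_scale[OF H(1)]) auto
    finally have "?q (x n - z n *\<^sub>C S (x n)) = ?q (x'' n - z n *\<^sub>C S (x'' n))"
      by (rule infdist_diff_mem[OF H(1)])
    then show ?thesis using x''2 by simp
  qed
  have "bounded (range x)" using h(2) by (auto simp: bounded_iff x_def intro!: exI[of _ 2])
  then obtain y r where r: "strict_mono (r :: nat \<Rightarrow> nat)" "(\<lambda>n. S (x (r n))) \<longlonglongrightarrow> y"
    using compact_operatorD(3)[OF S] by blast
  have "\<forall>n. (z \<circ> r) n \<in> cball 0 1" using zx(1) by simp
  then obtain \<zeta> r' where r': "\<zeta> \<in> cball 0 1" "strict_mono (r' :: nat \<Rightarrow> nat)" "((z \<circ> r) \<circ> r') \<longlonglongrightarrow> \<zeta>"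
    by (rule seq_compactE[OF compact_imp_seq_compact[OF compact_cball]])
  define s where "s = r \<circ> r'"
  have s: "strict_mono s" using r(1) r'(2) by (simp add: s_def strict_mono_o)
  have zs: "(\<lambda>n. z (s n)) \<longlonglongrightarrow> \<zeta>" using r'(3) by (simp add: s_def o_def)
  have Sxs: "(\<lambda>n. S (x (s n))) \<longlonglongrightarrow> y"
    using LIMSEQ_subseq_LIMSEQ[OF r(2) r'(2)] by (simp add: s_def o_def)
  have q0: "(\<lambda>n. ?q (x (s n) - \<zeta> *\<^sub>C y)) \<longlonglongrightarrow> 0"
  proof (rule tendsto_sandwich[OF _ _ tendsto_const])
    have "(\<lambda>n. z (s n) *\<^sub>C S (x (s n)) - \<zeta> *\<^sub>C y) \<longlonglongrightarrow> 0"
      using tendsto_diff[OF tendsto_scaleC[OF zs Sxs] tendsto_const, of "\<zeta> *\<^sub>C y"] by simp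
    then have "(\<lambda>n. norm (z (s n) *\<^sub>C S (x (s n)) - \<zeta> *\<^sub>C y)) \<longlonglongrightarrow> 0" by (rule tendsto_norm_zero)
    moreover have "(\<lambda>n. 1 / real (Suc (s n))) \<longlonglongrightarrow> 0"
      using LIMSEQ_subseq_LIMSEQ[OF LIMSEQ_Suc[OF lim_inverse_n'] s] by (simp add: o_def)
    ultimately show "(\<lambda>n. 1 / real (Suc (s n)) + norm (z (s n) *\<^sub>C S (x (s n)) - \<zeta> *\<^sub>C y)) \<longlonglongrightarrow> 0"
      by (rule tendsto_add_zero[rotated])
    show "\<forall>\<^sub>F n in sequentially. ?q (x (s n) - \<zeta> *\<^sub>C y)
        \<le> 1 / real (Suc (s n)) + norm (z (s n) *\<^sub>C S (x (s n)) - \<zeta> *\<^sub>C y)"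
    proof (rule always_eventually, rule allI)
      fix n
      have "?q (x (s n) - \<zeta> *\<^sub>C y) \<le> ?q (x (s n) - z (s n) *\<^sub>C S (x (s n))) + ?q (z (s n) *\<^sub>C S (x (s n)) - \<zeta> *\<^sub>C y)"
        using cseminorm_triangle[OF q, of "x (s n) - z (s n) *\<^sub>C S (x (s n))" "z (s n) *\<^sub>C S (x (s n)) - \<zeta> *\<^sub>C y"] by simp
      also have "\<dots> \<le> 1 / real (Suc (s n)) + norm (z (s n) *\<^sub>C S (x (s n)) - \<zeta> *\<^sub>C y)"
        using qx2[of "s n"] by (intro add_mono infdist_le_norm[OF H(1)]) simp
      finally show "?q (x (s n) - \<zeta> *\<^sub>C y) \<le> \<dots>" .
    qed
  qed (simp add: infdist_nonneg)
  obtain K where K: "0 \<le> K" "\<And>x. norm (S x) \<le> K * norm x"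
    using bounded_linear.nonneg_bounded[OF compact_operatorD(2)[OF S]] by (auto simp: mult.commute)
  have qS: "?q (S x) \<le> K * ?q x" for x
    using infdist_image_le[OF lin K(2) H(3) H(1) K(1)] .
  have "(\<lambda>n. ?q (S (x (s n)) - \<zeta> *\<^sub>C S y)) \<longlonglongrightarrow> 0"
  proof (rule tendsto_sandwich[OF _ _ tendsto_const])
    show "(\<lambda>n. K * ?q (x (s n) - \<zeta> *\<^sub>C y)) \<longlonglongrightarrow> 0" using tendsto_mult_right_zero[OF q0] .
    show "\<forall>\<^sub>F n in sequentially. ?q (S (x (s n)) - \<zeta> *\<^sub>C S y) \<le> K * ?q (x (s n) - \<zeta> *\<^sub>C y)"
      using qS by (intro always_eventually) (metis clinear_diff[OF lin] clinear_scaleC[OF lin])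
  qed (simp add: infdist_nonneg)
  moreover have "(\<lambda>n. ?q (S (x (s n)) - \<zeta> *\<^sub>C S y)) \<longlonglongrightarrow> ?q (y - \<zeta> *\<^sub>C S y)"
    by (intro tendsto_intros Sxs)
  ultimately have "?q (y - \<zeta> *\<^sub>C S y) = 0" using LIMSEQ_unique by blast
  then have "y - \<zeta> *\<^sub>C S y \<in> H" using in_closed_iff_infdist_zero[OF H(2) ne] by simp
  then have "y \<in> H" using r'(1) by (intro inj[of \<zeta> y]) simp_all
  then have "?q (x (s n) - \<zeta> *\<^sub>C y) = ?q (x (s n))" for n
    by (intro infdist_diff_mem[OF H(1)]) (simp add: complex_vector.subspace_neg[OF H(1)] complex_vector.subspace_scale[OF H(1)])
  then show False using q0 by (simp add: qx LIMSEQ_const_iff)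
qed

theorem decay_modulo_unstable_space:
  fixes S :: "'a::complex_banach \<Rightarrow> 'a"
  assumes S: "compact_operator S"
  shows "\<exists>N>0. \<forall>x. infdist ((S ^^ N) x) (unstable_space S) \<le> infdist x (unstable_space S) / 2"
proof -
  let ?H = "unstable_space S"
  note lin = compact_operatorD(1)[OF S]
  have H: "complex_vector.subspace ?H" "closed ?H" "S ` ?H \<subseteq> ?H"
    using subspace_unstable_space unstable_space_finite_dim[OF S] closed_span_finite
      unstable_space_invariant(1)[OF lin] by metis+
  \<comment> \<open>For nonzero \<open>z\<close> this concerns the number
    \<open>\<mu> = 1 / z\<close> of modulus at least 1; for \<open>z = 0\<close> the assumption
    already says that \<open>x\<close> lies in \<open>?H\<close>.\<close>
  have "x \<in> ?H" if "cmod z \<le> 1" "x - z *\<^sub>C S x \<in> ?H" for z x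
  proof (cases "z = 0")
    case False
    have "1 \<le> cmod (inverse z)" using that(1) False by (simp add: norm_inverse one_le_inverse)
    moreover have "inverse z *\<^sub>C x - S x = inverse z *\<^sub>C (x - z *\<^sub>C S x)"
      using False by (simp add: complex_vector.scale_right_diff_distrib scaleC_scaleC scaleC_one)
    then have "inverse z *\<^sub>C x - S x \<in> ?H"
      using that(2) complex_vector.subspace_scale[OF H(1)] by metis
    ultimately show ?thesis by (rule unstable_space_no_more_eigenvectors[OF lin])
  qed (use that in simp)
  then obtain c where c: "c > 0" "\<And>z x. cmod z \<le> 1 \<Longrightarrow> c * infdist x ?H \<le> infdist (x - z *\<^sub>C S x) ?H"
    using resolvent_lower_bound[OF S H] by blast
  obtain K where K: "0 \<le> K" "\<And>x. norm (S x) \<le> K * norm x"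
    using bounded_linear.nonneg_bounded[OF compact_operatorD(2)[OF S]] by (auto simp: mult.commute)
  show ?thesis
    using powers_eventually_small[OF cseminorm_infdist[OF H(1)] lin infdist_image_le[OF lin K(2) H(3) H(1) K(1)] c] .
qed

section \<open>Uniform boundedness\<close>

text \<open>Banach-Steinhaus by Baire category: the closed sets \<open>A n\<close> cover the space,
  so one of them contains a ball. Moving its centre to the origin doubles the bound, and scaling
  \<open>x\<close> to half the radius doubles it again, whence
  \<open>4 * real n / e\<close>.\<close>

theorem uniform_boundedness:
  fixes F :: "('a::banach \<Rightarrow> 'b::real_normed_vector) set"
  assumes F: "\<And>f. f \<in> F \<Longrightarrow> bounded_linear f" and bdd: "\<And>x. \<exists>K. \<forall>f\<in>F. norm (f x) \<le> K"
  shows "\<exists>M\<ge>0. \<forall>f\<in>F. \<forall>x. norm (f x) \<le> M * norm x"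
proof -
  define A where "A = (\<lambda>n::nat. {x. \<forall>f\<in>F. norm (f x) \<le> real n})"
  have clA: "closed (A n)" for n
  proof -
    have "closed {x. norm (f x) \<le> real n}" if "f \<in> F" for f
      using linear_continuous_on[OF F[OF that], of UNIV] by (intro closed_Collect_le continuous_intros)
    moreover have "A n = (\<Inter>f\<in>F. {x. norm (f x) \<le> real n})" by (auto simp: A_def)
    ultimately show ?thesis by auto
  qed
  have "\<exists>n. interior (A n) \<noteq> {}"
  proof (rule ccontr)
    assume "\<not> ?thesis"
    then have "Met_TC.mtopology interior_of (\<Union>(range A)) = {}"
      using clA complete_UNIV by (intro Met_TC.metric_Baire_category_alt) auto
    moreover have "\<Union>(range A) = UNIV"
    proof (rule UNIV_eq_I[symmetric])
      fix x
      obtain K where K: "\<forall>f\<in>F. norm (f x) \<le> K" using bdd by blast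
      obtain n where "K \<le> real n" using real_arch_simple by blast
      with K have "x \<in> A n" unfolding A_def by force
      then show "x \<in> \<Union>(range A)" by blast
    qed
    ultimately show False by simp
  qed
  then obtain n x0 where "x0 \<in> interior (A n)" by blast
  then obtain e where e: "0 < e" "ball x0 e \<subseteq> A n" by (meson mem_interior)
  have "norm (f x) \<le> 4 * real n / e * norm x" if f: "f \<in> F" for f x
  proof (cases "x = 0")
    case True
    then show ?thesis using linear_0[OF bounded_linear.linear[OF F[OF f]]] by simp
  next
    case False
    define r where "r = e / (2 * norm x)"
    have r: "0 < r" using e False by (simp add: r_def)
    have "norm (r *\<^sub>R x) < e" using e False by (simp add: r_def)
    then have "x0 + r *\<^sub>R x \<in> A n" "x0 \<in> A n" using e by (auto simp: dist_norm intro!: subsetD[OF e(2)])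
    then have "norm (f (x0 + r *\<^sub>R x)) \<le> real n" "norm (f x0) \<le> real n" using f by (auto simp: A_def)
    moreover have "r *\<^sub>R f x = f (x0 + r *\<^sub>R x) - f x0"
      using bounded_linear.linear[OF F[OF f]] by (simp add: linear_add linear_scale)
    ultimately have "norm (r *\<^sub>R f x) \<le> 2 * real n"
      using norm_triangle_ineq4[of "f (x0 + r *\<^sub>R x)" "f x0"] by simp
    then have "norm (f x) \<le> 2 * real n / r" using r by (simp add: field_simps)
    then show ?thesis using e False by (simp add: r_def)
  qed
  then show ?thesis using e by (intro exI[of _ "4 * real n / e"]) auto
qed

section \<open>Frechet spaces\<close>

text \<open>The class only asserts that a generating family exists. Choosing one allows limits to be
  tested seminorm by seminorm.\<close>

definition frechet_seminorm :: "nat \<Rightarrow> 'a::frechet_space \<Rightarrow> real" where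
  "frechet_seminorm = (SOME p. (\<forall>n. cseminorm (p n)) \<and>
     (\<forall>S. open S \<longleftrightarrow> (\<forall>x\<in>S. \<exists>N. \<exists>e>0. {y. \<forall>n\<le>N. p n (y - x) < e} \<subseteq> S)))"

lemma
  fixes S :: "'a::frechet_space set"
  shows cseminorm_frechet_seminorm: "cseminorm (frechet_seminorm n :: 'a \<Rightarrow> real)"
    and open_frechet_iff: "open S \<longleftrightarrow> (\<forall>x\<in>S. \<exists>N. \<exists>e>0. {y. \<forall>n\<le>N. frechet_seminorm n (y - x) < e} \<subseteq> S)"
proof -
  have "\<exists>p :: nat \<Rightarrow> 'a \<Rightarrow> real. (\<forall>n. cseminorm (p n)) \<and>
     (\<forall>S. open S \<longleftrightarrow> (\<forall>x\<in>S. \<exists>N. \<exists>e>0. {y. \<forall>n\<le>N. p n (y - x) < e} \<subseteq> S))"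
  proof -
    obtain p :: "nat \<Rightarrow> 'a \<Rightarrow> real" where "\<forall>n. cseminorm (p n)"
      "\<forall>S. open S \<longleftrightarrow> (\<forall>x\<in>S. \<exists>N. \<exists>e>0. {y. \<forall>n\<le>N. p n (y - x) < e} \<subseteq> S)"
      using frechet by (elim exE conjE) (rule that)
    then show ?thesis by blast
  qed
  from someI_ex[OF this] show "cseminorm (frechet_seminorm n :: 'a \<Rightarrow> real)"
    "open S \<longleftrightarrow> (\<forall>x\<in>S. \<exists>N. \<exists>e>0. {y. \<forall>n\<le>N. frechet_seminorm n (y - x) < e} \<subseteq> S)"
    unfolding frechet_seminorm_def by blast+
qed

lemma open_frechet_ball: "open {y. \<forall>n\<le>N. frechet_seminorm n (y - x) < e}"
  unfolding open_frechet_iff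
proof (intro ballI, clarify)
  fix y assume y: "\<forall>n\<le>N. frechet_seminorm n (y - x) < e"
  define d where "d = Min ((\<lambda>n. e - frechet_seminorm n (y - x)) ` {..N})"
  have d: "d \<le> e - frechet_seminorm n (y - x)" if "n \<le> N" for n
    unfolding d_def using that by (intro Min_le) auto
  have "0 < d" unfolding d_def using y by (subst Min_gr_iff) auto
  moreover have "frechet_seminorm n (z - x) < e" if "\<forall>n\<le>N. frechet_seminorm n (z - y) < d" "n \<le> N" for z n
    using cseminorm_triangle[OF cseminorm_frechet_seminorm, of n "z - y" "y - x"] that d[OF that(2)] by force
  ultimately show "\<exists>N' e'. 0 < e' \<and> {z. \<forall>n\<le>N'. frechet_seminorm n (z - y) < e'} \<subseteq> {y. \<forall>n\<le>N. frechet_seminorm n (y - x) < e}"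
    by blast
qed

lemma tendsto_frechet_iff:
  fixes l :: "'a::frechet_space"
  shows "(f \<longlongrightarrow> l) F \<longleftrightarrow> (\<forall>n. ((\<lambda>x. frechet_seminorm n (f x - l)) \<longlongrightarrow> 0) F)"
proof (intro iffI allI)
  fix n assume f: "(f \<longlongrightarrow> l) F"
  show "((\<lambda>x. frechet_seminorm n (f x - l)) \<longlongrightarrow> 0) F"
  proof (rule tendstoI)
    fix e :: real assume "0 < e"
    then have "eventually (\<lambda>x. f x \<in> {y. \<forall>m\<le>n. frechet_seminorm m (y - l) < e}) F"
      by (intro topological_tendstoD[OF f open_frechet_ball])
        (simp add: cseminorm_0[OF cseminorm_frechet_seminorm])
    then show "eventually (\<lambda>x. dist (frechet_seminorm n (f x - l)) 0 < e) F"
      by eventually_elim (simp add: cseminorm_nonneg[OF cseminorm_frechet_seminorm])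
  qed
next
  assume f: "\<forall>n. ((\<lambda>x. frechet_seminorm n (f x - l)) \<longlongrightarrow> 0) F"
  show "(f \<longlongrightarrow> l) F"
  proof (rule topological_tendstoI)
    fix S assume "open S" "l \<in> S"
    then obtain N e where N: "0 < e" "{y. \<forall>n\<le>N. frechet_seminorm n (y - l) < e} \<subseteq> S"
      unfolding open_frechet_iff by blast
    have "eventually (\<lambda>x. \<forall>n\<in>{..N}. frechet_seminorm n (f x - l) < e) F"
      using f N(1) by (intro eventually_ball_finite ballI order_tendstoD(2)[of _ 0]) auto
    then show "eventually (\<lambda>x. f x \<in> S) F"
      using N(2) by (auto elim!: eventually_mono)
  qed
qed

text \<open>Continuity of addition is not an axiom of the class; it comes from the triangle
  inequality of each seminorm.\<close>

lemma frechet_tendsto_add: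
  fixes a b :: "'a::frechet_space"
  assumes "(f \<longlongrightarrow> a) F" "(g \<longlongrightarrow> b) F"
  shows "((\<lambda>x. f x + g x) \<longlongrightarrow> a + b) F"
  unfolding tendsto_frechet_iff
proof
  fix n
  note p = cseminorm_frechet_seminorm[of n]
  show "((\<lambda>x. frechet_seminorm n (f x + g x - (a + b))) \<longlongrightarrow> 0) F"
  proof (rule tendsto_sandwich[OF _ _ tendsto_const])
    show "((\<lambda>x. frechet_seminorm n (f x - a) + frechet_seminorm n (g x - b)) \<longlongrightarrow> 0) F"
      using assms unfolding tendsto_frechet_iff by (intro tendsto_add_zero) auto
    show "eventually (\<lambda>x. frechet_seminorm n (f x + g x - (a + b)) \<le> frechet_seminorm n (f x - a) + frechet_seminorm n (g x - b)) F"
      using cseminorm_triangle[OF p, of "f x - a" "g x - b" for x]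
      by (intro always_eventually allI) (simp add: algebra_simps)
  qed (simp add: cseminorm_nonneg[OF p])
qed

text \<open>The Hausdorff axiom enters here: the constant sequence \<open>z\<close> converges both
  to \<open>z\<close> and to 0.\<close>

lemma frechet_seminorm_eq_0D:
  assumes "\<And>n. frechet_seminorm n z = 0"
  shows "z = 0"
proof -
  have "(\<lambda>_. z) \<longlonglongrightarrow> 0" unfolding tendsto_frechet_iff using assms by simp
  then show ?thesis using LIMSEQ_unique tendsto_const by blast
qed

lemma continuous_clinearD:
  assumes "continuous_clinear f"
  shows "clinear f" and "(g \<longlongrightarrow> l) F \<Longrightarrow> ((\<lambda>x. f (g x)) \<longlongrightarrow> f l) F"
proof -
  show "clinear f" using assms by (simp add: continuous_clinear_def)
  have "continuous_on UNIV f" using assms by (simp add: continuous_clinear_def)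
  then show "((\<lambda>x. f (g x)) \<longlongrightarrow> f l) F" if "(g \<longlongrightarrow> l) F"
    by (rule continuous_on_tendsto_compose[OF _ that]) auto
qed

section \<open>Derivatives in time\<close>

text \<open>As a relation, differentiation can be computed before \<open>time_deriv\<close> is known
  to be a genuine limit, and derivatives stay unconstrained at negative times.\<close>

abbreviation has_time_deriv :: "(real \<Rightarrow> 'a::{real_vector,t2_space}) \<Rightarrow> (real \<Rightarrow> 'a) \<Rightarrow> bool" where
  "has_time_deriv f f' \<equiv> (\<forall>t\<ge>0. (diff_quotient f t \<longlongrightarrow> f' t) (at t within {0..}))"

lemma at_right_le_at_within_Ici: "0 \<le> (t::real) \<Longrightarrow> at_right t \<le> at t within {0..}"
  by (rule at_le) auto

lemma at_within_Ici_neq_bot: "0 \<le> (t::real) \<Longrightarrow> at t within {0..} \<noteq> bot"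
  using at_right_le_at_within_Ici[of t] trivial_limit_at_right_real[of t]
  by (metis bot.extremum_uniqueI)

lemma time_deriv_unique:
  assumes "has_time_deriv f f'" "0 \<le> t"
  shows "time_deriv f t = f' t"
  unfolding time_deriv_def using assms by (intro tendsto_Lim at_within_Ici_neq_bot) auto

lemma has_time_deriv_time_deriv: "time_differentiable f \<Longrightarrow> has_time_deriv f (time_deriv f)"
  unfolding time_differentiable_def time_deriv_def
  by (metis at_within_Ici_neq_bot tendsto_Lim)

lemma has_time_deriv_imp_time_differentiable: "has_time_deriv f f' \<Longrightarrow> time_differentiable f"
  unfolding time_differentiable_def by blast

lemma has_time_deriv_cong:
  assumes "has_time_deriv f f'" "\<And>t. 0 \<le> t \<Longrightarrow> f t = g t" "\<And>t. 0 \<le> t \<Longrightarrow> f' t = g' t"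
  shows "has_time_deriv g g'"
proof (intro allI impI)
  fix t :: real assume t: "0 \<le> t"
  have "(diff_quotient f t \<longlongrightarrow> f' t) (at t within {0..})" using assms(1) t by blast
  moreover have "eventually (\<lambda>s. diff_quotient f t s = diff_quotient g t s) (at t within {0..})"
    unfolding eventually_at_filter using assms(2) t by (auto simp: diff_quotient_def)
  ultimately show "(diff_quotient g t \<longlongrightarrow> g' t) (at t within {0..})"
    using tendsto_cong assms(3)[OF t] by fastforce
qed

text \<open>Smoothness is shown by exhibiting all derivatives at once. The iterates of
  \<open>time_deriv\<close> are identified with \<open>F k\<close> at nonnegative times only, since
  they may differ from it elsewhere.\<close>

lemma Cinf_locI:
  assumes F: "\<And>k. has_time_deriv (F k) (F (Suc k))" and f: "\<And>t. 0 \<le> t \<Longrightarrow> f t = F 0 t"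
  shows "f \<in> Cinf_loc {0..}" and "0 \<le> t \<Longrightarrow> (time_deriv ^^ k) f t = F k t"
proof -
  have eq: "\<forall>t\<ge>0. (time_deriv ^^ k) f t = F k t" for k
  proof (induction k)
    case (Suc k)
    have "has_time_deriv ((time_deriv ^^ k) f) (F (Suc k))"
      by (rule has_time_deriv_cong[OF F]) (use Suc in auto)
    then show ?case using time_deriv_unique[of "(time_deriv ^^ k) f" "F (Suc k)"] by simp
  qed (simp add: f)
  then show "0 \<le> t \<Longrightarrow> (time_deriv ^^ k) f t = F k t" by blast
  have "has_time_deriv ((time_deriv ^^ k) f) (F (Suc k))" for k
    by (rule has_time_deriv_cong[OF F]) (use eq in auto)
  then show "f \<in> Cinf_loc {0..}"
    by (auto simp: Cinf_loc_def intro: has_time_deriv_imp_time_differentiable)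
qed

lemma Cinf_locD:
  "f \<in> Cinf_loc {0..} \<Longrightarrow> has_time_deriv ((time_deriv ^^ k) f) ((time_deriv ^^ Suc k) f)"
  using has_time_deriv_time_deriv[of "(time_deriv ^^ k) f"] by (simp add: Cinf_loc_def)

lemma time_deriv_in_Cinf_loc: "f \<in> Cinf_loc {0..} \<Longrightarrow> time_deriv f \<in> Cinf_loc {0..}"
proof -
  assume f: "f \<in> Cinf_loc {0..}"
  have "(time_deriv ^^ k) (time_deriv f) = (time_deriv ^^ Suc k) f" for k
    by (simp add: funpow_Suc_right del: funpow.simps)
  then show ?thesis using f unfolding Cinf_loc_def by (simp del: funpow.simps)
qed

lemma has_time_deriv_zero: "has_time_deriv (\<lambda>_. 0 :: 'a::{real_vector,t2_space}) (\<lambda>_. 0)"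
proof -
  have "diff_quotient (\<lambda>_. 0 :: 'a) t = (\<lambda>_. 0)" for t by (simp add: diff_quotient_def fun_eq_iff)
  then show ?thesis by simp
qed

lemma zero_in_Cinf_loc: "(\<lambda>_. 0) \<in> Cinf_loc {0..}"
  and funpow_time_deriv_zero: "0 \<le> t \<Longrightarrow> (time_deriv ^^ k) (\<lambda>_. 0) t = 0"
  using Cinf_locI[where F = "\<lambda>_ _. 0" and f = "\<lambda>_. 0"] has_time_deriv_zero by auto

lemma has_time_deriv_clinear:
  assumes "continuous_clinear L" "has_time_deriv f f'"
  shows "has_time_deriv (\<lambda>t. L (f t)) (\<lambda>t. L (f' t))"
proof -
  note L = continuous_clinearD(1)[OF assms(1)]
  have "diff_quotient (\<lambda>t. L (f t)) t = (\<lambda>s. L (diff_quotient f t s))" for t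
    by (simp add: diff_quotient_def clinear_scaleR[OF L] clinear_diff[OF L] fun_eq_iff)
  then show ?thesis using assms by (auto intro: continuous_clinearD(2)[OF assms(1)])
qed

lemma has_time_deriv_add:
  fixes f :: "real \<Rightarrow> 'a::frechet_space"
  assumes "has_time_deriv f f'" "has_time_deriv g g'"
  shows "has_time_deriv (\<lambda>t. f t + g t) (\<lambda>t. f' t + g' t)"
proof -
  have "diff_quotient (\<lambda>t. f t + g t) t = (\<lambda>s. diff_quotient f t s + diff_quotient g t s)" for t
    by (simp add: diff_quotient_def fun_eq_iff algebra_simps)
  then show ?thesis using assms by (auto intro: frechet_tendsto_add)
qed

lemma has_time_deriv_shift:
  fixes f :: "real \<Rightarrow> 'a::{real_vector,t2_space}"
  assumes "has_time_deriv f f'" "0 \<le> a"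
  shows "has_time_deriv (\<lambda>t. f (a + t)) (\<lambda>t. f' (a + t))"
proof (intro allI impI)
  fix t :: real assume t: "0 \<le> t"
  have "filterlim (\<lambda>s. a + s) (at (a + t) within {0..}) (at t within {0..})"
    using assms(2) by (auto simp: filterlim_at eventually_at_filter intro!: tendsto_intros)
  moreover have "(diff_quotient f (a + t) \<longlongrightarrow> f' (a + t)) (at (a + t) within {0..})"
    using assms t by auto
  ultimately have "((\<lambda>s. diff_quotient f (a + t) (a + s)) \<longlongrightarrow> f' (a + t)) (at t within {0..})"
    by (rule filterlim_compose[rotated])
  then show "(diff_quotient (\<lambda>t. f (a + t)) t \<longlongrightarrow> f' (a + t)) (at t within {0..})"
    by (simp add: diff_quotient_def[abs_def])
qed

lemma has_time_deriv_iff_has_vector_derivative: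
  fixes f :: "real \<Rightarrow> 'a::real_normed_vector"
  shows "has_time_deriv f f' \<longleftrightarrow> (\<forall>t\<ge>0. (f has_vector_derivative f' t) (at t within {0..}))"
proof -
  have "(diff_quotient f t \<longlongrightarrow> d) (at t within {0..}) \<longleftrightarrow> (f has_vector_derivative d) (at t within {0..})" for t d
  proof -
    have "(diff_quotient f t \<longlongrightarrow> d) (at t within {0..}) \<longleftrightarrow> ((\<lambda>s. norm (diff_quotient f t s - d)) \<longlongrightarrow> 0) (at t within {0..})"
      by (simp only: tendsto_norm_zero_iff) (rule LIM_zero_iff[symmetric])
    also have "\<dots> \<longleftrightarrow> ((\<lambda>s. norm ((1 / norm (s - t)) *\<^sub>R (f s - (f t + (s - t) *\<^sub>R d)))) \<longlongrightarrow> 0) (at t within {0..})"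
    proof (rule tendsto_cong, unfold eventually_at_filter, intro always_eventually allI impI)
      fix s assume "s \<noteq> t"
      then have "diff_quotient f t s - d = (f s - (f t + (s - t) *\<^sub>R d)) /\<^sub>R (s - t)"
        by (simp add: diff_quotient_def scaleR_diff_right scaleR_add_right)
      then show "norm (diff_quotient f t s - d) = norm ((1 / norm (s - t)) *\<^sub>R (f s - (f t + (s - t) *\<^sub>R d)))"
        unfolding norm_scaleR by (simp add: inverse_eq_divide)
    qed
    also have "\<dots> \<longleftrightarrow> (f has_vector_derivative d) (at t within {0..})"
      unfolding has_vector_derivative_def has_derivative_within tendsto_norm_zero_iff
      by (simp add: bounded_linear_scaleR_left)
    finally show ?thesis .
  qed
  then show ?thesis by blast
qed

lemma has_time_deriv_imp_continuous_on:
  fixes f :: "real \<Rightarrow> 'a::real_normed_vector"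
  assumes "has_time_deriv f f'"
  shows "continuous_on {0..} f"
  using assms unfolding has_time_deriv_iff_has_vector_derivative
  by (auto simp: continuous_on_eq_continuous_within intro: has_vector_derivative_continuous)

text \<open>Mean value inequality together with uniform continuity of \<open>f'\<close> on a compact
  interval, whose extra unit of length makes room for \<open>h + s\<close>. The uniformity in
  \<open>s\<close> allows the limit to pass under the integral.\<close>

lemma diff_quotient_uniform:
  fixes f :: "real \<Rightarrow> 'a::real_normed_vector"
  assumes f: "has_time_deriv f f'" and f': "continuous_on {0..} f'" and b: "0 \<le> b" and e: "0 < e"
  shows "\<exists>d>0. \<forall>h s. 0 < h \<and> h < d \<and> 0 \<le> s \<and> s \<le> b \<longrightarrow> norm ((f (h + s) - f s) /\<^sub>R h - f' s) \<le> e"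
proof -
  have "uniformly_continuous_on {0..b + 1} f'"
    using f' by (intro compact_uniformly_continuous continuous_on_subset[OF f']) auto
  then obtain d where d: "0 < d" "\<And>s r. s \<in> {0..b+1} \<Longrightarrow> r \<in> {0..b+1} \<Longrightarrow> dist r s < d \<Longrightarrow> dist (f' r) (f' s) < e"
    unfolding uniformly_continuous_on_def using e by metis
  have "norm ((f (h + s) - f s) /\<^sub>R h - f' s) \<le> e" if h: "0 < h" "h < min d 1" "0 \<le> s" "s \<le> b" for h s
  proof -
    have "norm (f (h + s) - f s - (h + s - s) *\<^sub>R f' s) \<le> norm (h + s - s) * e"
    proof (rule vector_differentiable_bound_linearization[where S = "{s..h+s}"])
      fix r assume r: "r \<in> {s..h+s}"
      have "0 \<le> r" using r h by simp
      then have "(f has_vector_derivative f' r) (at r within {0..})"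
        using f unfolding has_time_deriv_iff_has_vector_derivative by blast
      then show "(f has_vector_derivative f' r) (at r within {s..h+s})"
        by (rule has_vector_derivative_within_subset) (use h in auto)
      show "norm (f' r - f' s) \<le> e"
        using d(2)[of s r] r h by (auto simp: dist_norm)
    qed (use h in \<open>auto simp: closed_segment_eq_real_ivl\<close>)
    then have "norm (f (h + s) - f s - h *\<^sub>R f' s) \<le> h * e" using h by simp
    moreover have "(f (h + s) - f s) /\<^sub>R h - f' s = (f (h + s) - f s - h *\<^sub>R f' s) /\<^sub>R h"
      using h by (simp add: scaleR_diff_right)
    ultimately have "norm ((f (h + s) - f s) /\<^sub>R h - f' s) = norm (f (h + s) - f s - h *\<^sub>R f' s) / h"
      using h by (simp add: inverse_eq_divide)
    with \<open>norm (f (h + s) - f s - h *\<^sub>R f' s) \<le> h * e\<close> h show ?thesis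
      by (simp add: pos_divide_le_eq mult.commute)
  qed
  then show ?thesis using d(1) by (intro exI[of _ "min d 1"]) auto
qed

section \<open>Vanishing functions\<close>

text \<open>The local bound starts an induction over windows of length \<open>N\<close>. Once
  \<open>e\<close> is below \<open>\<epsilon> / 4\<close>, the map r to r/2 +
  \<open>\<epsilon> / 4\<close> has fixed point \<open>\<epsilon> / 2\<close>, and the excess over
  it halves from each window to the next.\<close>

lemma vanishing_contraction:
  fixes g e :: "real \<Rightarrow> real"
  assumes T: "time_set T" and N: "N \<in> T" "0 < N"
    and g0: "\<And>t. t \<in> T \<Longrightarrow> 0 \<le> g t" and g: "\<And>t. t \<in> T \<Longrightarrow> g (t + N) \<le> g t / 2 + e t"
    and e: "vanishing T e" and bdd: "\<And>b. \<exists>K. \<forall>t\<in>T. t \<le> b \<longrightarrow> g t \<le> K"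
  shows "vanishing T g"
proof -
  have sub: "t - N \<in> T" if "t \<in> T" "N \<le> t" for t
    using T N that by (auto simp: time_set_def Nats_diff)
  show ?thesis
    unfolding vanishing_def
  proof (rule tendstoI)
    fix \<epsilon> :: real assume \<epsilon>: "0 < \<epsilon>"
    have "eventually (\<lambda>t. t \<in> T \<longrightarrow> dist (e t) 0 < \<epsilon> / 4) at_top"
      using tendstoD[OF e[unfolded vanishing_def], of "\<epsilon> / 4"] \<epsilon> by (simp add: eventually_inf_principal)
    then obtain b' where b': "\<And>t. b' \<le> t \<Longrightarrow> t \<in> T \<Longrightarrow> e t \<le> \<epsilon> / 4"
      unfolding eventually_at_top_linorder by (fastforce simp: dist_real_def)
    define b where "b = max b' 0"
    have b: "e t \<le> \<epsilon> / 4" if "b \<le> t" "t \<in> T" for t using b' that by (simp add: b_def)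
    obtain K where K: "\<And>t. t \<in> T \<Longrightarrow> t \<le> b + N \<Longrightarrow> g t \<le> K" using bdd[of "b + N"] by blast
    have *: "\<forall>t\<in>T. b + real k * N \<le> t \<and> t \<le> b + real (Suc k) * N \<longrightarrow> g t \<le> \<bar>K\<bar> / 2 ^ k + \<epsilon> / 2" for k
    proof (induction k)
      case 0
      show ?case
      proof (intro ballI impI)
        fix t assume "t \<in> T" "b + real 0 * N \<le> t \<and> t \<le> b + real (Suc 0) * N"
        then show "g t \<le> \<bar>K\<bar> / 2 ^ 0 + \<epsilon> / 2" using K[of t] \<epsilon> by simp
      qed
    next
      case (Suc k)
      show ?case
      proof (intro ballI impI)
        fix t assume t: "t \<in> T" "b + real (Suc k) * N \<le> t \<and> t \<le> b + real (Suc (Suc k)) * N"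
        show "g t \<le> \<bar>K\<bar> / 2 ^ Suc k + \<epsilon> / 2"
        proof -
          have kN: "0 \<le> real k * N" "0 \<le> b" using N(2) by (auto simp: b_def)
          moreover have "b + real (Suc k) * N = N + (b + real k * N)" by (simp add: algebra_simps)
          ultimately have True: "N \<le> t" using t(2) by linarith
          have t': "b + real k * N \<le> t - N" "t - N \<le> b + real (Suc k) * N" using t(2) by (auto simp: algebra_simps)
          have "b \<le> t - N" using t'(1) kN by linarith
          then show ?thesis
            using g[OF sub[OF t(1) True]] b[of "t - N"] sub[OF t(1) True] Suc[rule_format, of "t - N"] t' by simp
        qed
      qed
    qed
    obtain m where "(1/2) ^ m < \<epsilon> / 2 / (\<bar>K\<bar> + 1)"
      using real_arch_pow_inv[of "\<epsilon> / 2 / (\<bar>K\<bar> + 1)" "1/2"] \<epsilon> by auto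
    then have m: "(\<bar>K\<bar> + 1) / 2 ^ m < \<epsilon> / 2" by (simp add: field_simps)
    have "dist (g t) 0 < \<epsilon>" if t: "b + real m * N \<le> t" "t \<in> T" for t
    proof -
      define k where "k = nat \<lfloor>(t - b) / N\<rfloor>"
      have "real m \<le> (t - b) / N" using t(1) N(2) by (simp add: field_simps)
      then have mk: "m \<le> k" "real k \<le> (t - b) / N" "(t - b) / N \<le> real (Suc k)"
        unfolding k_def by linarith+
      then have "b + real k * N \<le> t \<and> t \<le> b + real (Suc k) * N"
        using N(2) by (simp add: pos_le_divide_eq pos_divide_le_eq algebra_simps)
      then have "g t \<le> \<bar>K\<bar> / 2 ^ k + \<epsilon> / 2" using * t(2) by blast
      also have "\<bar>K\<bar> / 2 ^ k \<le> (\<bar>K\<bar> + 1) / 2 ^ m" using mk(1) by (intro frac_le) auto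
      finally have "g t < \<epsilon>" using m by linarith
      then show ?thesis using g0[OF t(2)] by simp
    qed
    then show "eventually (\<lambda>t. dist (g t) 0 < \<epsilon>) (inf at_top (principal T))"
      unfolding eventually_inf_principal eventually_at_top_linorder by blast
  qed
qed

section \<open>Semigroups and mild solutions\<close>

lemma Nats_neq_atLeast_0: "(\<nat> :: real set) \<noteq> {0..}"
proof
  assume "(\<nat> :: real set) = {0..}"
  moreover have "(1/2 :: real) \<in> {0..}" "(1/2 :: real) \<notin> \<nat>" by simp_all
  ultimately show False by metis
qed

lemma finite_Nats_bounded: "A \<subseteq> \<nat> \<Longrightarrow> (\<And>t. t \<in> A \<Longrightarrow> t \<le> b) \<Longrightarrow> finite (A :: real set)"
proof (rule finite_subset[of _ "real ` {..nat \<lfloor>b\<rfloor>}"])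
  assume A: "A \<subseteq> \<nat>" "\<And>t. t \<in> A \<Longrightarrow> t \<le> b"
  show "A \<subseteq> real ` {..nat \<lfloor>b\<rfloor>}"
  proof
    fix t assume "t \<in> A"
    then obtain n where "t = real n" "real n \<le> b" using A by (metis Nats_cases subsetD)
    then show "t \<in> real ` {..nat \<lfloor>b\<rfloor>}" by (auto simp: le_nat_floor)
  qed
qed simp

locale time_semigroup =
  fixes T :: "real set" and \<Phi> :: "real \<Rightarrow> 'x::complex_banach \<Rightarrow> 'x"
  assumes T: "time_set T" and \<Phi>: "semigroup_on T \<Phi>"
begin

lemma T_nonneg: "t \<in> T \<Longrightarrow> 0 \<le> t"
  using T by (auto simp: time_set_def elim: Nats_cases)

lemma T_0: "0 \<in> T" and T_of_nat: "real n \<in> T"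
  and T_add: "s \<in> T \<Longrightarrow> t \<in> T \<Longrightarrow> s + t \<in> T"
  and T_diff: "s \<in> T \<Longrightarrow> t \<in> T \<Longrightarrow> s \<le> t \<Longrightarrow> t - s \<in> T"
  and T_closed: "closed T"
  using T by (auto simp: time_set_def Nats_diff)

lemma bounded_clinear_\<Phi>: "t \<in> T \<Longrightarrow> bounded_clinear (\<Phi> t)"
  using \<Phi> by (simp add: semigroup_on_def)

lemmas clinear_\<Phi> = bounded_clinearD(1)[OF bounded_clinear_\<Phi>]
  and bounded_linear_\<Phi> = bounded_clinearD(2)[OF bounded_clinear_\<Phi>]

lemma \<Phi>_0: "\<Phi> 0 x = x"
  using \<Phi> by (simp add: semigroup_on_def)

lemma \<Phi>_add: "s \<in> T \<Longrightarrow> t \<in> T \<Longrightarrow> \<Phi> (s + t) x = \<Phi> s (\<Phi> t x)"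
  using \<Phi> by (simp add: semigroup_on_def)

lemma \<Phi>_commute: "s \<in> T \<Longrightarrow> t \<in> T \<Longrightarrow> \<Phi> s (\<Phi> t x) = \<Phi> t (\<Phi> s x)"
  by (metis \<Phi>_add add.commute)

lemma \<Phi>_continuous: "continuous_on T (\<lambda>t. \<Phi> t x)"
  using \<Phi> by (simp add: semigroup_on_def)

lemma \<Phi>_of_nat: "\<Phi> (real n) x = (\<Phi> 1 ^^ n) x"
proof (induction n)
  case (Suc n)
  have "\<Phi> (1 + real n) x = \<Phi> 1 (\<Phi> (real n) x)" using T_of_nat[of 1] T_of_nat[of n] by (intro \<Phi>_add) auto
  then show ?case using Suc by simp
qed (simp add: \<Phi>_0)

text \<open>Continuity of each orbit on a compact time set bounds the operators pointwise;
  Banach-Steinhaus makes the bound uniform.\<close>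

lemma \<Phi>_locally_bounded: "\<exists>M\<ge>0. \<forall>t\<in>T. t \<le> b \<longrightarrow> (\<forall>x. norm (\<Phi> t x) \<le> M * norm x)"
proof -
  let ?I = "T \<inter> {0..b}"
  have "\<exists>M\<ge>0. \<forall>f\<in>\<Phi> ` ?I. \<forall>x. norm (f x) \<le> M * norm x"
  proof (rule uniform_boundedness)
    show "bounded_linear f" if "f \<in> \<Phi> ` ?I" for f using that bounded_linear_\<Phi> by auto
    fix x
    have "compact ?I" using T_closed by (simp add: closed_Int_compact)
    then have "bounded ((\<lambda>t. \<Phi> t x) ` ?I)"
      using continuous_on_subset[OF \<Phi>_continuous] by (intro compact_imp_bounded compact_continuous_image) auto
    then show "\<exists>K. \<forall>f\<in>\<Phi> ` ?I. norm (f x) \<le> K" unfolding bounded_iff by auto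
  qed
  then show ?thesis using T_nonneg by auto
qed

section \<open>Mild solutions: convolution estimates, restarting and differentiation\<close>

definition time_continuous :: "(real \<Rightarrow> 'a::topological_space) \<Rightarrow> bool" where
  "time_continuous v \<longleftrightarrow> (T = {0..} \<longrightarrow> continuous_on {0..} v)"

lemma time_continuous_iff: "T = {0..} \<Longrightarrow> time_continuous v \<longleftrightarrow> continuous_on {0..} v"
  unfolding time_continuous_def by blast

definition mild :: "(real \<Rightarrow> 'x) \<Rightarrow> (real \<Rightarrow> 'x) \<Rightarrow> bool" where
  "mild x v \<longleftrightarrow> (\<forall>t\<in>T. x t = \<Phi> t (x 0) + time_integral T {0<..t} (\<lambda>s. \<Phi> (t - s) (v s)))"

lemma time_integral_continuous_time:
  assumes "T = {0..}"
  shows "time_integral T {0<..t} f = integral {0..t} f"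
proof -
  have "integral {0<..t} f = integral {0..t} f"
    by (rule integral_subset_negligible) (auto intro: negligible_subset[of "{0}"])
  moreover have "{0<..t} \<inter> {0..} = {0<..t}" by auto
  ultimately show ?thesis using assms by (simp add: time_integral_def)
qed

lemma time_integral_discrete_time:
  "T = \<nat> \<Longrightarrow> time_integral T {0<..t} f = sum f ({0<..t} \<inter> \<nat>)"
  using Nats_neq_atLeast_0 by (simp add: time_integral_def)

lemma T_cases: obtains "T = {0..}" | "T = \<nat>"
  using T by (auto simp: time_set_def)

lemma time_integral_cong:
  assumes "\<And>s. s \<in> T \<Longrightarrow> 0 < s \<Longrightarrow> s \<le> t \<Longrightarrow> f s = g s"
  shows "time_integral T {0<..t} f = time_integral T {0<..t} g"
  unfolding time_integral_def using assms by (auto intro!: integral_cong sum.cong)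

text \<open>Since \<open>\<Phi>\<close> is only strongly continuous, \<open>v s\<close> is split
  into the fixed vector \<open>v r\<close>, whose orbit is continuous, and the small
  \<open>v s - v r\<close>, on which the operators are uniformly bounded.\<close>

lemma convolution_continuous:
  assumes "T = {0..}" "time_continuous v"
  shows "continuous_on {0..t} (\<lambda>s. \<Phi> (t - s) (v s))"
proof (cases "0 \<le> t")
  case True
  obtain M where M: "0 \<le> M" "\<And>r x. r \<in> T \<Longrightarrow> r \<le> t \<Longrightarrow> norm (\<Phi> r x) \<le> M * norm x"
    using \<Phi>_locally_bounded[of t] by blast
  have v: "continuous_on {0..t} v"
    using assms(2) unfolding time_continuous_iff[OF assms(1)] by (rule continuous_on_subset) auto
  show ?thesis
    unfolding continuous_on_def
  proof
    fix r assume r: "r \<in> {0..t}"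
    have "((\<lambda>s. \<Phi> (t - s) (v r)) \<longlongrightarrow> \<Phi> (t - r) (v r)) (at r within {0..t})"
    proof -
      have "continuous_on {0..t} (\<lambda>s. \<Phi> (t - s) (v r))"
        using \<Phi>_continuous[of "v r"] assms(1)
        by (intro continuous_on_compose2[of T "\<lambda>t. \<Phi> t (v r)" "{0..t}" "\<lambda>s. t - s"] continuous_intros) auto
      then show ?thesis using r by (simp add: continuous_on_def)
    qed
    moreover have "((\<lambda>s. \<Phi> (t - s) (v s - v r)) \<longlongrightarrow> 0) (at r within {0..t})"
    proof (rule Lim_null_comparison)
      show "eventually (\<lambda>s. norm (\<Phi> (t - s) (v s - v r)) \<le> M * norm (v s - v r)) (at r within {0..t})"
        unfolding eventually_at_filter using assms(1) by (auto intro!: always_eventually M(2))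
      have "(v \<longlongrightarrow> v r) (at r within {0..t})" using v r by (simp add: continuous_on_def)
      then show "((\<lambda>s. M * norm (v s - v r)) \<longlongrightarrow> 0) (at r within {0..t})"
        by (intro tendsto_mult_right_zero tendsto_norm_zero LIM_zero)
    qed
    ultimately have "((\<lambda>s. \<Phi> (t - s) (v r) + \<Phi> (t - s) (v s - v r)) \<longlongrightarrow> \<Phi> (t - r) (v r) + 0) (at r within {0..t})"
      by (rule tendsto_add)
    then have "((\<lambda>s. \<Phi> (t - s) (v r) + \<Phi> (t - s) (v s - v r)) \<longlongrightarrow> \<Phi> (t - r) (v r)) (at r within {0..t})" by simp
    moreover have "eventually (\<lambda>s. \<Phi> (t - s) (v r) + \<Phi> (t - s) (v s - v r) = \<Phi> (t - s) (v s)) (at r within {0..t})"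
      unfolding eventually_at_filter using assms(1)
      by (auto intro!: always_eventually simp: clinear_diff[OF clinear_\<Phi>])
    ultimately show "((\<lambda>s. \<Phi> (t - s) (v s)) \<longlongrightarrow> \<Phi> (t - r) (v r)) (at r within {0..t})"
      by (rule Lim_transform_eventually)
  qed
qed simp

text \<open>The point is that \<open>K\<close> depends on \<open>b\<close> alone. It can then be
  applied to all time shifts of an input, and to difference quotients of an input.\<close>

lemma time_integral_convolution_bound:
  assumes b: "b \<in> T"
  shows "\<exists>K\<ge>0. \<forall>v c. time_continuous v \<longrightarrow> 0 \<le> c \<longrightarrow> (\<forall>s\<in>T. s \<le> b \<longrightarrow> norm (v s) \<le> c) \<longrightarrow>
    norm (time_integral T {0<..b} (\<lambda>s. \<Phi> (b - s) (v s))) \<le> K * c"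
proof -
  obtain M where M: "0 \<le> M" "\<And>r x. r \<in> T \<Longrightarrow> r \<le> b \<Longrightarrow> norm (\<Phi> r x) \<le> M * norm x"
    using \<Phi>_locally_bounded[of b] by blast
  have le: "norm (\<Phi> (b - s) (v s)) \<le> M * c" if "\<forall>s\<in>T. s \<le> b \<longrightarrow> norm (v s) \<le> c" "s \<in> T" "s \<le> b" for v c s
  proof -
    have "norm (\<Phi> (b - s) (v s)) \<le> M * norm (v s)"
      using that T_nonneg[OF that(2)] by (intro M(2) T_diff b) auto
    also have "\<dots> \<le> M * c" using that M(1) by (intro mult_left_mono) auto
    finally show ?thesis .
  qed
  show ?thesis
  proof (cases rule: T_cases)
    case 1
    have "norm (time_integral T {0<..b} (\<lambda>s. \<Phi> (b - s) (v s))) \<le> M * b * c"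
      if "time_continuous v" "\<forall>s\<in>T. s \<le> b \<longrightarrow> norm (v s) \<le> c" for v c
      unfolding time_integral_continuous_time[OF 1]
      using integral_bound[OF T_nonneg[OF b] convolution_continuous[OF 1 that(1)], of "M * c"] le[OF that(2)] 1
      by (simp add: mult.commute mult.left_commute)
    then show ?thesis using M(1) T_nonneg[OF b] by (intro exI[of _ "M * b"]) auto
  next
    case 2
    have "norm (time_integral T {0<..b} (\<lambda>s. \<Phi> (b - s) (v s))) \<le> (M * card ({0<..b} \<inter> \<nat>)) * c"
      if "\<forall>s\<in>T. s \<le> b \<longrightarrow> norm (v s) \<le> c" for v c
      unfolding time_integral_discrete_time[OF 2]
      using sum_norm_bound[of "{0<..b} \<inter> \<nat>" "\<lambda>s. \<Phi> (b - s) (v s)" "M * c"] le[OF that] 2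
      by (simp add: mult.commute mult.left_commute)
    then show ?thesis using M(1) by (intro exI[of _ "M * card ({0<..b} \<inter> \<nat>)"]) auto
  qed
qed

lemma time_integral_linear:
  assumes L: "bounded_linear L" and f: "T = {0..} \<Longrightarrow> continuous_on {0..t} f"
  shows "time_integral T {0<..t} (\<lambda>s. L (f s)) = L (time_integral T {0<..t} f)"
proof (cases rule: T_cases)
  case 1
  show ?thesis
    unfolding time_integral_continuous_time[OF 1]
    using integral_linear[OF integrable_continuous_real[OF f[OF 1]] L] by (simp add: o_def)
next
  case 2
  show ?thesis
    unfolding time_integral_discrete_time[OF 2] by (simp add: linear_sum[OF bounded_linear.linear[OF L]])
qed

text \<open>The half-open intervals are disjoint, which matters under counting measure; in
  continuous time endpoints are negligible.\<close>

lemma time_integral_split: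
  assumes a: "a \<in> T" and t: "t \<in> T" and f: "T = {0..} \<Longrightarrow> continuous_on {0..a + t} f"
  shows "time_integral T {0<..a + t} f = time_integral T {0<..a} f + time_integral T {0<..t} (\<lambda>s. f (a + s))"
proof (cases rule: T_cases)
  case 1
  have "integral {0..a} f + integral {a..a + t} f = integral {0..a + t} f"
    using T_nonneg[OF a] T_nonneg[OF t] integrable_continuous_real[OF f[OF 1]] by (intro Henstock_Kurzweil_Integration.integral_combine) auto
  moreover have "integral {0..t} (\<lambda>s. f (a + s)) = integral {a..a + t} f"
    using integral_shift_Icc_real[of 0 t f a] by (simp add: o_def add.commute)
  ultimately show ?thesis by (simp add: time_integral_continuous_time[OF 1])
next
  case 2
  have split: "{0<..a + t} \<inter> \<nat> = ({0<..a} \<inter> \<nat>) \<union> (+) a ` ({0<..t} \<inter> \<nat>)"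
  proof (intro equalityI subsetI)
    fix s assume s: "s \<in> {0<..a + t} \<inter> \<nat>"
    show "s \<in> ({0<..a} \<inter> \<nat>) \<union> (+) a ` ({0<..t} \<inter> \<nat>)"
    proof (cases "s \<le> a")
      case False
      then have "s - a \<in> {0<..t} \<inter> \<nat>" using s T_diff[OF a, of s] 2 by auto
      then show ?thesis by (auto intro!: image_eqI[of _ _ "s - a"])
    qed (use s in auto)
  next
    fix s assume "s \<in> ({0<..a} \<inter> \<nat>) \<union> (+) a ` ({0<..t} \<inter> \<nat>)"
    then show "s \<in> {0<..a + t} \<inter> \<nat>"
      using T_nonneg[OF a] T_nonneg[OF t] a 2 by auto
  qed
  have fin: "finite ({0<..b} \<inter> \<nat> :: real set)" for b by (rule finite_Nats_bounded[of _ b]) auto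
  have "sum f ({0<..a + t} \<inter> \<nat>) = sum f ({0<..a} \<inter> \<nat>) + sum f ((+) a ` ({0<..t} \<inter> \<nat>))"
    unfolding split using fin by (intro sum.union_disjoint) auto
  also have "sum f ((+) a ` ({0<..t} \<inter> \<nat>)) = sum (\<lambda>s. f (a + s)) ({0<..t} \<inter> \<nat>)"
    by (subst sum.reindex) (auto simp: o_def)
  finally show ?thesis by (simp add: time_integral_discrete_time[OF 2])
qed

text \<open>The state at time \<open>a\<close> may serve as a new initial value: by the semigroup
  law \<open>\<Phi> t\<close> factors out of everything that happened up to time
  \<open>a\<close>.\<close>

lemma mild_shift:
  assumes x: "mild x v" and v: "time_continuous v" and a: "a \<in> T"
  shows "mild (\<lambda>t. x (a + t)) (\<lambda>t. v (a + t))"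
  unfolding mild_def
proof
  fix t assume t: "t \<in> T"
  have at: "a + t \<in> T" using a t by (rule T_add)
  let ?f = "\<lambda>s. \<Phi> (a + t - s) (v s)"
  have "x (a + t) = \<Phi> (a + t) (x 0) + time_integral T {0<..a + t} ?f"
    using x at by (simp add: mild_def)
  also have "time_integral T {0<..a + t} ?f = time_integral T {0<..a} ?f + time_integral T {0<..t} (\<lambda>s. ?f (a + s))"
    using convolution_continuous[OF _ v] by (intro time_integral_split a t)
  also have "time_integral T {0<..a} ?f = time_integral T {0<..a} (\<lambda>s. \<Phi> t (\<Phi> (a - s) (v s)))"
  proof (rule time_integral_cong)
    fix s assume s: "s \<in> T" "0 < s" "s \<le> a"
    show "\<Phi> (a + t - s) (v s) = \<Phi> t (\<Phi> (a - s) (v s))"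
      using \<Phi>_add[OF t T_diff[OF s(1) a s(3)]] by (simp add: algebra_simps)
  qed
  also have "\<dots> = \<Phi> t (time_integral T {0<..a} (\<lambda>s. \<Phi> (a - s) (v s)))"
    by (intro time_integral_linear bounded_linear_\<Phi> t convolution_continuous v)
  also have "\<Phi> (a + t) (x 0) = \<Phi> t (\<Phi> a (x 0))"
    using \<Phi>_add[OF t a] by (simp add: add.commute)
  finally have "x (a + t) = \<Phi> t (\<Phi> a (x 0) + time_integral T {0<..a} (\<lambda>s. \<Phi> (a - s) (v s)))
      + time_integral T {0<..t} (\<lambda>s. \<Phi> (t - s) (v (a + s)))"
    by (simp add: clinear_add[OF clinear_\<Phi>[OF t]] algebra_simps)
  also have "\<Phi> a (x 0) + time_integral T {0<..a} (\<lambda>s. \<Phi> (a - s) (v s)) = x a"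
    using x a by (simp add: mild_def)
  finally show "x (a + t) = \<Phi> t (x (a + 0)) + time_integral T {0<..t} (\<lambda>s. \<Phi> (t - s) (v (a + s)))"
    by simp
qed

lemma time_continuous_shift:
  assumes "time_continuous v" "a \<in> T"
  shows "time_continuous (\<lambda>t. v (a + t))"
  unfolding time_continuous_def
  using assms T_nonneg[OF assms(2)]
  by (auto simp: time_continuous_def intro!: continuous_on_compose2[of "{0..}" v _ "\<lambda>t. a + t"] continuous_intros)

lemma time_continuous_locally_bounded:
  fixes x :: "real \<Rightarrow> 'x"
  assumes "time_continuous x"
  shows "\<exists>K. \<forall>t\<in>T. t \<le> b \<longrightarrow> norm (x t) \<le> K"
proof -
  have "bounded (x ` (T \<inter> {..b}))"
  proof (cases rule: T_cases)
    case 1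
    have "T \<inter> {..b} = {0..b}" using 1 by auto
    moreover have "continuous_on {0..b} x"
      using assms unfolding time_continuous_iff[OF 1] by (rule continuous_on_subset) auto
    ultimately show ?thesis by (simp add: compact_imp_bounded compact_continuous_image)
  next
    case 2
    then have "finite (T \<inter> {..b})" by (intro finite_Nats_bounded[of _ b]) auto
    then show ?thesis by (intro finite_imp_bounded) auto
  qed
  then show ?thesis unfolding bounded_iff by auto
qed

lemma vanishing_iff:
  fixes f :: "real \<Rightarrow> 'a::real_normed_vector"
  shows "vanishing T f \<longleftrightarrow> (\<forall>e>0. \<exists>b. \<forall>t\<in>T. b \<le> t \<longrightarrow> norm (f t) < e)"
  unfolding vanishing_def tendsto_iff eventually_inf_principal eventually_at_top_linorder dist_0_norm dist_norm
  by (simp add: Ball_def) (meson order_refl)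

text \<open>Restart the solution at \<open>t\<close> and run it for \<open>N\<close> time units. The
  free part halves the distance to \<open>H\<close>, and the forced part \<open>e t\<close> depends
  only on the input after \<open>t\<close>, hence is eventually small.\<close>

lemma mild_vanishing_modulo_unstable_space:
  assumes compact: "compact_operator (\<Phi> 1)" and x: "mild x v"
    and cont: "time_continuous x" "time_continuous v" and v: "vanishing T v"
  shows "vanishing T (\<lambda>t. infdist (x t) (unstable_space (\<Phi> 1)))"
proof -
  let ?H = "unstable_space (\<Phi> 1)"
  note q = cseminorm_infdist[OF subspace_unstable_space]
  obtain N where N: "0 < N" "\<And>x. infdist ((\<Phi> 1 ^^ N) x) ?H \<le> infdist x ?H / 2"
    using decay_modulo_unstable_space[OF compact] by blast
  define e where "e = (\<lambda>t. norm (time_integral T {0<..real N} (\<lambda>s. \<Phi> (real N - s) (v (t + s)))))"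
  obtain K where K: "0 \<le> K" "\<And>v c. time_continuous v \<Longrightarrow> 0 \<le> c \<Longrightarrow> (\<forall>s\<in>T. s \<le> real N \<longrightarrow> norm (v s) \<le> c) \<Longrightarrow>
    norm (time_integral T {0<..real N} (\<lambda>s. \<Phi> (real N - s) (v s))) \<le> K * c"
    using time_integral_convolution_bound[OF T_of_nat[of N]] by blast
  show ?thesis
  proof (rule vanishing_contraction[OF T T_of_nat[of N], where e = e])
    show "vanishing T e"
      unfolding vanishing_iff
    proof (intro allI impI)
      fix \<epsilon> :: real assume \<epsilon>: "0 < \<epsilon>"
      \<comment> \<open>\<open>K + 1\<close> rather than \<open>K\<close> keeps the quotient
        meaningful when \<open>K = 0\<close>.\<close>
      define c where "c = \<epsilon> / (2 * (K + 1))"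
      have c: "0 < c" using \<epsilon> K(1) by (simp add: c_def)
      obtain b where b: "\<And>t. t \<in> T \<Longrightarrow> b \<le> t \<Longrightarrow> norm (v t) < c" using v c unfolding vanishing_iff by blast
      have "norm (e t) < \<epsilon>" if t: "t \<in> T" "b \<le> t" for t
      proof -
        have "norm (e t) \<le> K * c"
          unfolding e_def real_norm_def abs_norm_cancel
        proof (intro K(2) time_continuous_shift cont t ballI impI)
          fix s assume "s \<in> T"
          then show "norm (v (t + s)) \<le> c" using b[of "t + s"] T_add[of t s] T_nonneg[of s] t by force
        qed (use c in simp)
        also have "\<dots> \<le> (K + 1) * c" using c by (simp add: algebra_simps)
        also have "\<dots> = \<epsilon> / 2" using K(1) by (simp add: c_def field_simps)
        also have "\<dots> < \<epsilon>" using \<epsilon> by simp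
        finally show ?thesis .
      qed
      then show "\<exists>b. \<forall>t\<in>T. b \<le> t \<longrightarrow> norm (e t) < \<epsilon>" by blast
    qed
    show "infdist (x (t + real N)) ?H \<le> infdist (x t) ?H / 2 + e t" if t: "t \<in> T" for t
    proof -
      have "x (t + real N) = \<Phi> (real N) (x t) + time_integral T {0<..real N} (\<lambda>s. \<Phi> (real N - s) (v (t + s)))"
        using mild_shift[OF x cont(2) t] T_of_nat[of N] unfolding mild_def by auto
      then have "infdist (x (t + real N)) ?H \<le> infdist (\<Phi> (real N) (x t)) ?H
          + infdist (time_integral T {0<..real N} (\<lambda>s. \<Phi> (real N - s) (v (t + s)))) ?H"
        using cseminorm_triangle[OF q] by simp
      also have "\<dots> \<le> infdist (x t) ?H / 2 + e t"
        unfolding e_def \<Phi>_of_nat by (intro add_mono N(2) infdist_le_norm subspace_unstable_space)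
      finally show ?thesis .
    qed
    fix b
    obtain C where "\<forall>t\<in>T. t \<le> b \<longrightarrow> norm (x t) \<le> C" using time_continuous_locally_bounded[OF cont(1)] by blast
    then show "\<exists>K. \<forall>t\<in>T. t \<le> b \<longrightarrow> infdist (x t) ?H \<le> K"
      using infdist_le_norm[OF subspace_unstable_space] order_trans by blast
  qed (use N in \<open>auto simp: infdist_nonneg\<close>)
qed

text \<open>Differentiating \<open>\<Phi> (t - s)\<close> would bring in an unbounded generator.
  Instead the solution restarted at a small time \<open>h\<close> is compared with the original one,
  so that only the initial value and the input are differenced.\<close>

lemma mild_time_deriv:
  assumes T0: "T = {0..}" and x: "mild x v" and dx: "has_time_deriv x x'" and dv: "has_time_deriv v v'"
    and v': "continuous_on {0..} v'"
  shows "mild x' v'"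
  unfolding mild_def
proof
  fix t assume t: "t \<in> T"
  then have t0: "0 \<le> t" by (rule T_nonneg)
  have contv: "time_continuous v" "time_continuous v'"
    using has_time_deriv_imp_continuous_on[OF dv] v' by (auto simp: time_continuous_def)
  let ?I = "\<lambda>w. integral {0..t} (\<lambda>s. \<Phi> (t - s) (w s))"
  note int = integrable_continuous_real[OF convolution_continuous[OF T0]]
  have shift: "filterlim (\<lambda>h. h + t) (at t within {0..}) (at_right 0)" if "0 \<le> t" for t :: real
    using that by (auto simp: filterlim_at eventually_at_filter intro!: tendsto_eq_intros)
  have lhs: "((\<lambda>h. (x (h + t) - x t) /\<^sub>R h) \<longlongrightarrow> x' t) (at_right 0)" if "0 \<le> t" for t
    using filterlim_compose[OF _ shift[OF that], of "diff_quotient x t" "nhds (x' t)"] dx that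
    by (simp add: diff_quotient_def)
  \<comment> \<open>The error made when the difference quotient of the input is replaced by
    \<open>v'\<close>.\<close>
  define E where "E = (\<lambda>h. ?I (\<lambda>s. (v (h + s) - v s) /\<^sub>R h - v' s))"
  have eq: "(x (h + t) - x t) /\<^sub>R h = \<Phi> t ((x (h + 0) - x 0) /\<^sub>R h) + ?I v' + E h" if h: "0 < h" for h
  proof -
    have hT: "h \<in> T" using h T0 by simp
    have contvh: "time_continuous (\<lambda>s. v (h + s))" by (intro time_continuous_shift contv hT)
    have 1: "x (h + t) = \<Phi> t (x (h + 0)) + ?I (\<lambda>s. v (h + s))"
      using mild_shift[OF x contv(1) hT] t unfolding mild_def time_integral_continuous_time[OF T0] by blast
    have 2: "x t = \<Phi> t (x 0) + ?I v"
      using x t unfolding mild_def time_integral_continuous_time[OF T0] by blast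
    have "E h = integral {0..t} (\<lambda>s. (\<Phi> (t - s) (v (h + s)) - \<Phi> (t - s) (v s)) /\<^sub>R h - \<Phi> (t - s) (v' s))"
      unfolding E_def using T0
      by (intro integral_cong) (simp add: clinear_diff[OF clinear_\<Phi>] clinear_scaleR[OF clinear_\<Phi>])
    also have "\<dots> = (?I (\<lambda>s. v (h + s)) - ?I v) /\<^sub>R h - ?I v'"
      using int[OF contvh, of t] int[OF contv(1), of t] int[OF contv(2), of t]
      by (simp add: integral_diff integrable_diff integrable_cmul)
    finally show ?thesis
      unfolding 1 2
      by (simp add: clinear_diff[OF clinear_\<Phi>[OF t]] clinear_scaleR[OF clinear_\<Phi>[OF t]] scaleR_diff_right scaleR_add_right)
  qed
  obtain K where K: "0 \<le> K" "\<And>v c. time_continuous v \<Longrightarrow> 0 \<le> c \<Longrightarrow> (\<forall>s\<in>T. s \<le> t \<longrightarrow> norm (v s) \<le> c) \<Longrightarrow>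
    norm (time_integral T {0<..t} (\<lambda>s. \<Phi> (t - s) (v s))) \<le> K * c"
    using time_integral_convolution_bound[OF t] by blast
  have "(E \<longlongrightarrow> 0) (at_right 0)"
  proof (rule tendstoI)
    fix \<epsilon> :: real assume \<epsilon>: "0 < \<epsilon>"
    define c where "c = \<epsilon> / (2 * (K + 1))"
    have c: "0 < c" using \<epsilon> K(1) by (simp add: c_def)
    obtain d where d: "0 < d" "\<And>h s. 0 < h \<Longrightarrow> h < d \<Longrightarrow> 0 \<le> s \<Longrightarrow> s \<le> t \<Longrightarrow> norm ((v (h + s) - v s) /\<^sub>R h - v' s) \<le> c"
      using diff_quotient_uniform[OF dv v' t0 c] by blast
    have "dist (E h) 0 < \<epsilon>" if h: "0 < h" "h < d" for h
    proof -
      have "norm (E h) \<le> K * c"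
        unfolding E_def time_integral_continuous_time[OF T0, symmetric]
      proof (rule K(2))
        have "continuous_on {0..} (\<lambda>s. v (h + s))"
          using time_continuous_shift[OF contv(1), of h] h T0 unfolding time_continuous_iff[OF T0] by simp
        then show "time_continuous (\<lambda>s. (v (h + s) - v s) /\<^sub>R h - v' s)"
          using contv unfolding time_continuous_iff[OF T0] by (intro continuous_intros)
      qed (use c d(2) h T0 in auto)
      also have "\<dots> \<le> (K + 1) * c" using c by (simp add: algebra_simps)
      also have "\<dots> = \<epsilon> / 2" using K(1) by (simp add: c_def field_simps)
        also have "\<dots> < \<epsilon>" using \<epsilon> by simp
      finally show ?thesis by simp
    qed
    then show "eventually (\<lambda>h. dist (E h) 0 < \<epsilon>) (at_right 0)"
      using d(1) by (auto simp: eventually_at_right_field)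
  qed
  then have "((\<lambda>h. \<Phi> t ((x (h + 0) - x 0) /\<^sub>R h) + ?I v' + E h) \<longlongrightarrow> \<Phi> t (x' 0) + ?I v' + 0) (at_right 0)"
    using lhs[of 0] by (intro tendsto_add bounded_linear.tendsto[OF bounded_linear_\<Phi>[OF t]] tendsto_const) auto
  moreover have "eventually (\<lambda>h. \<Phi> t ((x (h + 0) - x 0) /\<^sub>R h) + ?I v' + E h = (x (h + t) - x t) /\<^sub>R h) (at_right 0)"
    unfolding eventually_at_filter using eq by (auto intro!: always_eventually)
  ultimately have "((\<lambda>h. (x (h + t) - x t) /\<^sub>R h) \<longlongrightarrow> \<Phi> t (x' 0) + ?I v' + 0) (at_right 0)"
    by (rule Lim_transform_eventually)
  then have "x' t = \<Phi> t (x' 0) + ?I v' + 0"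
    using lhs[OF t0] tendsto_unique[OF trivial_limit_at_right_real] by blast
  then show "x' t = \<Phi> t (x' 0) + time_integral T {0<..t} (\<lambda>s. \<Phi> (t - s) (v' s))"
    by (simp add: time_integral_continuous_time[OF T0])
qed

end

section \<open>Smooth orbits in finite-dimensional invariant subspaces\<close>

text \<open>Riemann sums over fine tagged divisions lie in \<open>V\<close> and come arbitrarily
  close to the integral.\<close>

lemma integral_in_closed_subspace:
  fixes f :: "real \<Rightarrow> 'a::complex_banach"
  assumes V: "complex_vector.subspace V" "closed V" and f: "f integrable_on {a..b}"
    and fV: "\<And>s. s \<in> {a..b} \<Longrightarrow> f s \<in> V"
  shows "integral {a..b} f \<in> V"
proof -
  have "\<exists>w\<in>V. dist w (integral {a..b} f) < e" if "0 < e" for e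
  proof -
    have "(f has_integral integral {a..b} f) (cbox a b)" using integrable_integral[OF f] by simp
    then have "\<exists>\<gamma>. gauge \<gamma> \<and> (\<forall>\<D>. \<D> tagged_division_of (cbox a b) \<and> \<gamma> fine \<D> \<longrightarrow>
        norm ((\<Sum>(x, k)\<in>\<D>. measure lborel k *\<^sub>R f x) - integral {a..b} f) < e)"
      unfolding has_integral using \<open>0 < e\<close> by (elim allE impE)
    then obtain \<gamma> where \<gamma>: "gauge \<gamma>" and fine: "\<forall>\<D>. \<D> tagged_division_of (cbox a b) \<and> \<gamma> fine \<D> \<longrightarrow>
        norm ((\<Sum>(x, k)\<in>\<D>. measure lborel k *\<^sub>R f x) - integral {a..b} f) < e"
      by (elim exE conjE) (rule that)
    obtain \<D> where \<D>: "\<D> tagged_division_of (cbox a b)" "\<gamma> fine \<D>"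
      by (rule fine_division_exists[OF \<gamma>])
    have "(\<Sum>(x, k)\<in>\<D>. measure lborel k *\<^sub>R f x) \<in> V"
    proof (rule complex_vector.subspace_sum[OF V(1)], clarify)
      fix x k assume "(x, k) \<in> \<D>"
      then have "x \<in> {a..b}" using tag_in_interval[OF \<D>(1)] by auto
      then show "measure lborel k *\<^sub>R f x \<in> V"
        using fV by (simp add: scaleR_eq_scaleC complex_vector.subspace_scale[OF V(1)])
    qed
    then show ?thesis using fine[rule_format, OF conjI[OF \<D>]] unfolding dist_norm by (rule rev_bexI)
  qed
  then have "integral {a..b} f \<in> closure V" by (simp add: closure_approachable)
  then show ?thesis using V(2) by simp
qed

lemma continuous_clinear_scaleC:
  "continuous_clinear ((*\<^sub>C) c :: 'a::complex_banach \<Rightarrow> 'a)"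
  unfolding continuous_clinear_def
proof
  show "clinear ((*\<^sub>C) c :: 'a \<Rightarrow> 'a)"
    by (rule clinearI) (simp_all add: scaleC_add_right scaleC_scaleC mult.commute)
  show "continuous_on UNIV ((*\<^sub>C) c :: 'a \<Rightarrow> 'a)"
    unfolding continuous_on_def by (auto intro!: tendsto_scaleC tendsto_intros)
qed

context time_semigroup
begin

lemma has_time_deriv_integral_orbit:
  assumes T0: "T = {0..}"
  shows "has_time_deriv (\<lambda>t. integral {0..t} (\<lambda>s. \<Phi> s v)) (\<lambda>t. \<Phi> t v)"
  unfolding has_time_deriv_iff_has_vector_derivative
proof (intro allI impI)
  fix t :: real assume t: "0 \<le> t"
  have "continuous_on {0..t + 1} (\<lambda>s. \<Phi> s v)"
    by (rule continuous_on_subset[OF \<Phi>_continuous]) (simp add: T0)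
  then have "((\<lambda>t. integral {0..t} (\<lambda>s. \<Phi> s v)) has_vector_derivative \<Phi> t v) (at t within {0..t + 1})"
    using t by (intro integral_has_vector_derivative) auto
  moreover have "at t within {0..t + 1} = at t within {0..}"
    by (rule at_within_nhd[of _ "{..<t + 1}"]) auto
  ultimately show "((\<lambda>t. integral {0..t} (\<lambda>s. \<Phi> s v)) has_vector_derivative \<Phi> t v) (at t within {0..})"
    by simp
qed

text \<open>The vectors of \<open>V\<close> with differentiable orbits form a subspace
  \<open>D\<close>, closed because \<open>V\<close> is finite-dimensional. It contains the integrals
  \<open>F h\<close> of the orbit of \<open>v\<close>, and \<open>F h\<close> divided by
  \<open>h\<close> tends to \<open>v\<close>.\<close>

lemma orbit_differentiable:
  assumes T0: "T = {0..}" and B: "finite B" and V: "V = complex_vector.span B"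
    and inv: "\<And>t. t \<in> T \<Longrightarrow> \<Phi> t ` V \<subseteq> V" and v: "v \<in> V"
  shows "\<exists>d. has_time_deriv (\<lambda>t. \<Phi> t v) d"
proof -
  have subV: "complex_vector.subspace V" and clV: "closed V"
    using B by (simp_all add: V complex_vector.subspace_span closed_span_finite)
  define D where "D = {v \<in> V. \<exists>d. has_time_deriv (\<lambda>t. \<Phi> t v) d}"
  have DI: "v \<in> D" if "v \<in> V" "has_time_deriv (\<lambda>t. \<Phi> t v) d" for v d
    unfolding D_def mem_Collect_eq using that by (intro conjI exI[of _ d])
  have D: "complex_vector.subspace D"
  proof (rule complex_vector.subspaceI)
    have "has_time_deriv (\<lambda>t. \<Phi> t 0) (\<lambda>_. 0)"
      by (rule has_time_deriv_cong[OF has_time_deriv_zero]) (simp_all add: T0 clinear_0[OF clinear_\<Phi>])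
    then show "0 \<in> D" by (rule DI[OF complex_vector.subspace_0[OF subV]])
  next
    fix x y assume "x \<in> D" "y \<in> D"
    then obtain d d' where d: "x \<in> V" "y \<in> V" "has_time_deriv (\<lambda>t. \<Phi> t x) d" "has_time_deriv (\<lambda>t. \<Phi> t y) d'"
      unfolding D_def by auto
    have "has_time_deriv (\<lambda>t. \<Phi> t (x + y)) (\<lambda>t. d t + d' t)"
      by (rule has_time_deriv_cong[OF has_time_deriv_add[OF d(3,4)]]) (simp_all add: T0 clinear_add[OF clinear_\<Phi>])
    then show "x + y \<in> D" by (rule DI[OF complex_vector.subspace_add[OF subV d(1,2)]])
  next
    fix c x assume "x \<in> D"
    then obtain d where d: "x \<in> V" "has_time_deriv (\<lambda>t. \<Phi> t x) d" unfolding D_def by auto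
    have "has_time_deriv (\<lambda>t. \<Phi> t (c *\<^sub>C x)) (\<lambda>t. c *\<^sub>C d t)"
      by (rule has_time_deriv_cong[OF has_time_deriv_clinear[OF continuous_clinear_scaleC[of c] d(2)]])
        (simp_all add: T0 clinear_scaleC[OF clinear_\<Phi>])
    then show "c *\<^sub>C x \<in> D" by (rule DI[OF complex_vector.subspace_scale[OF subV d(1)]])
  qed
  have "D \<subseteq> complex_vector.span B" unfolding D_def V by blast
  then have "closed D" by (rule closed_subspace_of_span_finite[OF B D])
  define F where "F = (\<lambda>t. integral {0..t} (\<lambda>s. \<Phi> s v))"
  note dF = has_time_deriv_integral_orbit[OF T0, of v, folded F_def]
  have int: "(\<lambda>s. \<Phi> s v) integrable_on {a..b}" if "0 \<le> a" for a b
    using that by (intro integrable_continuous_real continuous_on_subset[OF \<Phi>_continuous]) (auto simp: T0)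
  have FD: "F h \<in> D" if h: "0 < h" for h
  proof -
    have "F h \<in> V"
      unfolding F_def using inv v T0 by (intro integral_in_closed_subspace subV clV int) auto
    \<comment> \<open>The orbit of \<open>F h\<close> is a difference of two values of the primitive
      \<open>F\<close>, which is differentiable by the fundamental theorem of calculus.\<close>
    moreover have "has_time_deriv (\<lambda>t. F (h + t) - F t) (\<lambda>t. \<Phi> (h + t) v - \<Phi> t v)"
      using has_time_deriv_shift[OF dF, of h] dF h
      unfolding has_time_deriv_iff_has_vector_derivative by (auto intro!: has_vector_derivative_diff)
    then have "has_time_deriv (\<lambda>t. \<Phi> t (F h)) (\<lambda>t. \<Phi> (h + t) v - \<Phi> t v)"
    proof (rule has_time_deriv_cong)
      fix t :: real assume t: "0 \<le> t"
      have "\<Phi> t (F h) = integral {0..h} (\<lambda>s. \<Phi> t (\<Phi> s v))"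
        unfolding F_def using integral_linear[OF int[of 0 h] bounded_linear_\<Phi>[of t]] t T0 by (simp add: o_def)
      also have "\<dots> = integral {0..h} (\<lambda>s. \<Phi> (t + s) v)"
        using t T0 by (intro integral_cong) (simp add: \<Phi>_add)
      also have "\<dots> = integral {t..h + t} (\<lambda>s. \<Phi> s v)"
        using integral_shift_Icc_real[of 0 h "\<lambda>s. \<Phi> s v" t] by (simp add: o_def)
      also have "\<dots> = F (h + t) - F t"
        using Henstock_Kurzweil_Integration.integral_combine[of 0 t "h + t", OF _ _ int] t h
        by (simp add: F_def algebra_simps)
      finally show "F (h + t) - F t = \<Phi> t (F h)" by simp
    qed simp
    ultimately show ?thesis by (rule DI)
  qed
  have "(diff_quotient F 0 \<longlongrightarrow> \<Phi> 0 v) (at 0 within {0..})" using dF by simp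
  moreover have "eventually (\<lambda>s. diff_quotient F 0 s \<in> D) (at 0 within {0..})"
    unfolding eventually_at_filter
  proof (intro always_eventually allI impI)
    fix s :: real assume "s \<noteq> 0" "s \<in> {0..}"
    then have "F s \<in> D" by (intro FD) simp
    then show "diff_quotient F 0 s \<in> D"
      by (simp add: diff_quotient_def F_def scaleR_eq_scaleC complex_vector.subspace_scale[OF D])
  qed
  ultimately have "\<Phi> 0 v \<in> D"
    by (rule Lim_in_closed_set[OF \<open>closed D\<close> _ at_within_Ici_neq_bot[OF order_refl], rotated])
  then show ?thesis by (simp add: D_def \<Phi>_0)
qed

text \<open>\<open>A\<close> is the generator on \<open>V\<close>. It maps \<open>V\<close> to
  itself, and the derivative of the orbit of \<open>w\<close> is the orbit of \<open>A w\<close>, so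
  differentiation can be iterated.\<close>

lemma orbit_smooth:
  assumes T0: "T = {0..}" and B: "finite B" and V: "V = complex_vector.span B"
    and inv: "\<And>t. t \<in> T \<Longrightarrow> \<Phi> t ` V \<subseteq> V" and v: "v \<in> V"
  shows "(\<lambda>t. \<Phi> t v) \<in> Cinf_loc {0..}"
proof -
  have subV: "complex_vector.subspace V" and clV: "closed V"
    using B by (simp_all add: V complex_vector.subspace_span closed_span_finite)
  define A where "A = (\<lambda>v. time_deriv (\<lambda>t. \<Phi> t v) 0)"
  have A: "has_time_deriv (\<lambda>t. \<Phi> t w) (\<lambda>t. \<Phi> t (A w))" "A w \<in> V" if w: "w \<in> V" for w
  proof -
    obtain d where d: "has_time_deriv (\<lambda>t. \<Phi> t w) d"
      using orbit_differentiable[OF T0 B V inv w] by blast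
    have A: "A w = d 0" unfolding A_def using time_deriv_unique[OF d] by simp
    have shift: "filterlim (\<lambda>h. h + t) (at t within {0..}) (at_right 0)" if "0 \<le> t" for t :: real
      using that by (auto simp: filterlim_at eventually_at_filter intro!: tendsto_eq_intros)
    have lim: "((\<lambda>h. (\<Phi> (h + t) w - \<Phi> t w) /\<^sub>R h) \<longlongrightarrow> d t) (at_right 0)" if "0 \<le> t" for t
      using filterlim_compose[OF _ shift[OF that], of "diff_quotient (\<lambda>t. \<Phi> t w) t" "nhds (d t)"] d that
      by (simp add: diff_quotient_def)
    \<comment> \<open>As \<open>d t\<close> is known to exist, it may be computed from the right,
      where the semigroup law reduces it to time 0.\<close>
    have "d t = \<Phi> t (A w)" if t: "0 \<le> t" for t
    proof -
      have tT: "t \<in> T" using t T0 by simp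
      have "((\<lambda>h. \<Phi> t ((\<Phi> (h + 0) w - \<Phi> 0 w) /\<^sub>R h)) \<longlongrightarrow> \<Phi> t (d 0)) (at_right 0)"
        by (intro bounded_linear.tendsto[OF bounded_linear_\<Phi>[OF tT]] lim) simp
      moreover have "eventually (\<lambda>h. \<Phi> t ((\<Phi> (h + 0) w - \<Phi> 0 w) /\<^sub>R h) = (\<Phi> (h + t) w - \<Phi> t w) /\<^sub>R h) (at_right 0)"
        unfolding eventually_at_filter
      proof (intro always_eventually allI impI)
        fix h :: real assume "h \<in> {0<..}"
        then have "h \<in> T" using T0 by simp
        then have "\<Phi> (h + t) w = \<Phi> t (\<Phi> h w)" using \<Phi>_add[OF tT] by (simp add: add.commute)
        then show "\<Phi> t ((\<Phi> (h + 0) w - \<Phi> 0 w) /\<^sub>R h) = (\<Phi> (h + t) w - \<Phi> t w) /\<^sub>R h"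
          by (simp add: clinear_diff[OF clinear_\<Phi>[OF tT]] clinear_scaleR[OF clinear_\<Phi>[OF tT]] \<Phi>_0)
      qed
      ultimately have "((\<lambda>h. (\<Phi> (h + t) w - \<Phi> t w) /\<^sub>R h) \<longlongrightarrow> \<Phi> t (d 0)) (at_right 0)"
        by (rule Lim_transform_eventually)
      then show ?thesis using lim[OF t] tendsto_unique[OF trivial_limit_at_right_real] A by metis
    qed
    then show "has_time_deriv (\<lambda>t. \<Phi> t w) (\<lambda>t. \<Phi> t (A w))"
      by (intro has_time_deriv_cong[OF d]) simp_all
    have "(diff_quotient (\<lambda>t. \<Phi> t w) 0 \<longlongrightarrow> d 0) (at 0 within {0..})" using d by simp
    moreover have "eventually (\<lambda>s. diff_quotient (\<lambda>t. \<Phi> t w) 0 s \<in> V) (at 0 within {0..})"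
      unfolding eventually_at_filter
    proof (intro always_eventually allI impI)
      fix s :: real assume "s \<in> {0..}"
      then have "\<Phi> s w \<in> V" using inv[of s] w T0 by auto
      then show "diff_quotient (\<lambda>t. \<Phi> t w) 0 s \<in> V"
        using w by (simp add: diff_quotient_def \<Phi>_0 scaleR_eq_scaleC complex_vector.subspace_scale[OF subV]
          complex_vector.subspace_diff[OF subV])
    qed
    ultimately have "d 0 \<in> V"
      by (rule Lim_in_closed_set[OF clV _ at_within_Ici_neq_bot[OF order_refl], rotated])
    then show "A w \<in> V" by (simp add: A)
  qed
  have AV: "(A ^^ k) v \<in> V" for k
    by (induction k) (simp_all add: v A(2))
  show ?thesis
    by (rule Cinf_locI(1)[where F = "\<lambda>k t. \<Phi> t ((A ^^ k) v)"]) (use A(1)[OF AV] in simp_all)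
qed

end

section \<open>The system relation\<close>

locale linear_system = time_semigroup T \<Phi>
  for T and \<Phi> :: "real \<Rightarrow> 'x::complex_banach \<Rightarrow> 'x" +
  fixes B :: "'u::frechet_space \<Rightarrow> 'x" and C :: "'x \<Rightarrow> 'y::frechet_space" and D :: "'u \<Rightarrow> 'y"
  assumes B: "continuous_clinear B" and C: "continuous_clinear C" and D: "continuous_clinear D"
    and compact: "compact_operator (\<Phi> 1)"
begin

abbreviation "P \<equiv> system_relation T \<Phi> B C D"
abbreviation "H \<equiv> unstable_space (\<Phi> 1)"

lemma relation_iff:
  "(u, y) \<in> P \<longleftrightarrow> u \<in> Cinf_loc T \<and> y \<in> Cinf_loc T \<and>
    (\<exists>x\<in>Cinf_loc T. mild x (\<lambda>t. B (u t)) \<and> (\<forall>t\<in>T. y t = C (x t) + D (u t)))"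
  by (auto simp: system_relation_def mild_def)

lemma Cinf_loc_time_continuous:
  fixes x :: "real \<Rightarrow> 'x"
  assumes "x \<in> Cinf_loc T"
  shows "time_continuous x"
  unfolding time_continuous_def
proof
  assume "T = {0..}"
  then show "continuous_on {0..} x"
    using has_time_deriv_imp_continuous_on[OF Cinf_locD[of x 0]] assms by simp
qed

lemma Cinf_loc_input_time_continuous:
  assumes "u \<in> Cinf_loc T"
  shows "time_continuous (\<lambda>t. B (u t))"
  unfolding time_continuous_def
proof
  assume "T = {0..}"
  then have "has_time_deriv u (time_deriv u)" using Cinf_locD[of u 0] assms by simp
  then show "continuous_on {0..} (\<lambda>t. B (u t))"
    by (rule has_time_deriv_imp_continuous_on[OF has_time_deriv_clinear[OF B]])
qed

lemma T_1: "1 \<in> T"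
  using T_of_nat[of 1] by simp

lemma \<Phi>_invariant:
  assumes "t \<in> T"
  shows "\<Phi> t ` H \<subseteq> H" and "\<Phi> t ` generalized_eigenvectors (\<Phi> 1) \<mu> \<subseteq> generalized_eigenvectors (\<Phi> 1) \<mu>"
  using unstable_space_invariant[where F = "\<Phi> t" and S = "\<Phi> 1", OF clinear_\<Phi>[OF assms] \<Phi>_commute[OF assms T_1]]
  by blast+

text \<open>\<open>C\<close> does not change when the state is corrected by elements
  \<open>h t\<close> of \<open>H\<close>. The corrected state tends to 0, so continuity of
  \<open>C\<close> at 0 applies.\<close>

lemma VIVO_if_unstable_space_in_kernel:
  assumes H: "H \<subseteq> {x. C x = 0}"
  shows "VIVO T P"
  unfolding VIVO_def
proof (intro ballI, clarify)
  fix u y assume uy: "(u, y) \<in> P" and u: "vanishing T u"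
  then obtain x where x: "u \<in> Cinf_loc T" "x \<in> Cinf_loc T" "mild x (\<lambda>t. B (u t))" "\<And>t. t \<in> T \<Longrightarrow> y t = C (x t) + D (u t)"
    unfolding relation_iff by blast
  note clin = continuous_clinearD(1)[OF C]
  have "vanishing T (\<lambda>t. B (u t))"
    using continuous_clinearD(2)[OF B u[unfolded vanishing_def]] clinear_0[OF continuous_clinearD(1)[OF B]]
    by (simp add: vanishing_def)
  then have q: "vanishing T (\<lambda>t. infdist (x t) H)"
    using x by (intro mild_vanishing_modulo_unstable_space[OF compact x(3)] Cinf_loc_time_continuous Cinf_loc_input_time_continuous)
  have clH: "closed H" using unstable_space_finite_dim[OF compact] closed_span_finite by metis
  have "\<exists>h. h \<in> H \<and> norm (x t - h) \<le> 2 * infdist (x t) H" for t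
    by (rule near_best_approximation[OF subspace_unstable_space clH]) blast
  then obtain h where h: "\<And>t. h t \<in> H" "\<And>t. norm (x t - h t) \<le> 2 * infdist (x t) H" by metis
  have "((\<lambda>t. 2 * infdist (x t) H) \<longlongrightarrow> 0) (inf at_top (principal T))"
    using q unfolding vanishing_def by (rule tendsto_mult_right_zero)
  then have "((\<lambda>t. x t - h t) \<longlongrightarrow> 0) (inf at_top (principal T))"
    by (rule Lim_null_comparison[OF always_eventually[OF allI[OF h(2)]]])
  then have "((\<lambda>t. C (x t - h t)) \<longlongrightarrow> C 0) (inf at_top (principal T))" by (rule continuous_clinearD(2)[OF C])
  moreover have "C (x t - h t) = C (x t)" for t using h(1)[of t] H by (auto simp: clinear_diff[OF clin])
  ultimately have "((\<lambda>t. C (x t) + D (u t)) \<longlongrightarrow> C 0 + D 0) (inf at_top (principal T))"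
    using continuous_clinearD(2)[OF D u[unfolded vanishing_def]] by (intro frechet_tendsto_add) simp_all
  then have "((\<lambda>t. C (x t) + D (u t)) \<longlongrightarrow> 0) (inf at_top (principal T))"
    by (simp add: clinear_0[OF clin] clinear_0[OF continuous_clinearD(1)[OF D]])
  moreover have "eventually (\<lambda>t. C (x t) + D (u t) = y t) (inf at_top (principal T))"
    by (auto simp: eventually_inf_principal x(4))
  ultimately show "vanishing T y"
    unfolding vanishing_def by (rule Lim_transform_eventually)
qed

section \<open>Time derivatives of pairs, and the implications among VIVO, smooth VIVO and
  stability\<close>

lemma relation_time_deriv:
  assumes T0: "T = {0..}" and uy: "(u, y) \<in> P"
  shows "(time_deriv u, time_deriv y) \<in> P"
proof -
  obtain x where x: "u \<in> Cinf_loc T" "y \<in> Cinf_loc T" "x \<in> Cinf_loc T" "mild x (\<lambda>t. B (u t))" "\<And>t. t \<in> T \<Longrightarrow> y t = C (x t) + D (u t)"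
    using uy unfolding relation_iff by blast
  have du: "has_time_deriv u (time_deriv u)" and dx: "has_time_deriv x (time_deriv x)"
    and dy: "has_time_deriv y (time_deriv y)"
    using Cinf_locD[of u 0] Cinf_locD[of x 0] Cinf_locD[of y 0] x(1,2,3) unfolding T0 by simp_all
  have C': "time_deriv u \<in> Cinf_loc T" "time_deriv y \<in> Cinf_loc T" "time_deriv x \<in> Cinf_loc T"
    using x(1-3) time_deriv_in_Cinf_loc unfolding T0 by blast+
  have "continuous_on {0..} (\<lambda>t. B (time_deriv u t))"
    using Cinf_loc_input_time_continuous[OF C'(1)] unfolding time_continuous_iff[OF T0] .
  then have "mild (time_deriv x) (\<lambda>t. B (time_deriv u t))"
    by (rule mild_time_deriv[OF T0 x(4) dx has_time_deriv_clinear[OF B du]])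
  moreover have "time_deriv y t = C (time_deriv x t) + D (time_deriv u t)" if "t \<in> T" for t
  proof -
    have "has_time_deriv y (\<lambda>t. C (time_deriv x t) + D (time_deriv u t))"
      by (rule has_time_deriv_cong[OF has_time_deriv_add[OF has_time_deriv_clinear[OF C dx] has_time_deriv_clinear[OF D du]]])
        (simp_all add: x(5) T0)
    from time_deriv_unique[OF this T_nonneg[OF that]] show ?thesis .
  qed
  ultimately show ?thesis unfolding relation_iff using C' by blast
qed

lemma VIVO_imp_smoothly_VIVO:
  assumes "VIVO T P"
  shows "smoothly_VIVO T P"
  unfolding smoothly_VIVO_def
proof (intro ballI, clarify)
  fix u y assume uy: "(u, y) \<in> P" and u: "smoothly_vanishing T u"
  show "smoothly_vanishing T y"
  proof (cases "T = {0..}")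
    case True
    have "((time_deriv ^^ k) u, (time_deriv ^^ k) y) \<in> P" for k
      by (induction k) (simp_all add: uy relation_time_deriv[OF True])
    then show ?thesis
      using u assms unfolding smoothly_vanishing_def VIVO_def if_P[OF True] by blast
  next
    case False
    then show ?thesis using u uy assms by (auto simp: smoothly_vanishing_def VIVO_def)
  qed
qed

lemma VIVO_imp_stable: "VIVO T P \<Longrightarrow> is_stable T P"
  unfolding VIVO_def is_stable_def by (auto simp: vanishing_def)

lemma smoothly_VIVO_imp_stable:
  assumes "smoothly_VIVO T P"
  shows "is_stable T P"
  unfolding is_stable_def
proof (intro allI impI)
  fix y assume y: "(\<lambda>_. 0, y) \<in> P"
  have "smoothly_vanishing T (\<lambda>_. 0 :: 'u)"
  proof (cases "T = {0..}")
    case True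
    have "vanishing T ((time_deriv ^^ k) (\<lambda>_. 0 :: 'u))" for k
      unfolding vanishing_def
      by (rule Lim_transform_eventually[OF tendsto_const])
        (auto simp: eventually_inf_principal True funpow_time_deriv_zero)
    then show ?thesis unfolding smoothly_vanishing_def if_P[OF True] by blast
  qed (simp add: smoothly_vanishing_def vanishing_def)
  then have "smoothly_vanishing T y" using assms y unfolding smoothly_VIVO_def by blast
  then have "vanishing T ((time_deriv ^^ 0) y)"
    unfolding smoothly_vanishing_def by (cases "T = {0..}") (metis, simp)
  then show "vanishing T y" by simp
qed

text \<open>Stability speaks only about smooth states, so the orbit must first be shown admissible;
  this uses that \<open>v\<close> lies in the finite-dimensional invariant space
  \<open>H\<close>.\<close>

lemma stable_imp_orbit_vanishing:
  assumes st: "is_stable T P" and v: "v \<in> H"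
  shows "vanishing T (\<lambda>t. C (\<Phi> t v))"
proof -
  have smooth: "(\<lambda>t. \<Phi> t v) \<in> Cinf_loc T" "(\<lambda>t. C (\<Phi> t v)) \<in> Cinf_loc T" "(\<lambda>_. 0 :: 'u) \<in> Cinf_loc T"
  proof -
    obtain A where A: "finite A" "H = complex_vector.span A" using unstable_space_finite_dim[OF compact] by metis
    have x: "(\<lambda>t. \<Phi> t v) \<in> Cinf_loc {0..}" if "T = {0..}"
      using orbit_smooth[OF that A \<Phi>_invariant(1) v] by blast
    have "(\<lambda>t. C (\<Phi> t v)) \<in> Cinf_loc {0..}" if "T = {0..}"
      by (rule Cinf_locI(1)[where F = "\<lambda>k t. C ((time_deriv ^^ k) (\<lambda>t. \<Phi> t v) t)"])
        (use has_time_deriv_clinear[OF C Cinf_locD[OF x[OF that]]] in simp_all)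
    then show "(\<lambda>t. \<Phi> t v) \<in> Cinf_loc T" "(\<lambda>t. C (\<Phi> t v)) \<in> Cinf_loc T" "(\<lambda>_. 0 :: 'u) \<in> Cinf_loc T"
      using x zero_in_Cinf_loc by (cases "T = {0..}"; force simp: Cinf_loc_def)+
  qed
  have "time_integral T {0<..t} (\<lambda>s. \<Phi> (t - s) (B 0)) = 0" if "t \<in> T" for t
  proof -
    have "time_integral T {0<..t} (\<lambda>s. \<Phi> (t - s) (B 0)) = time_integral T {0<..t} (\<lambda>_. 0)"
      by (rule time_integral_cong)
        (simp add: clinear_0[OF continuous_clinearD(1)[OF B]] clinear_0[OF clinear_\<Phi>] T_diff that)
    then show ?thesis by (simp add: time_integral_def)
  qed
  then have "mild (\<lambda>t. \<Phi> t v) (\<lambda>t. B 0)" by (simp add: mild_def \<Phi>_0)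
  then have "((\<lambda>_. 0), (\<lambda>t. C (\<Phi> t v))) \<in> P"
    unfolding relation_iff using smooth
    by (auto simp: clinear_0[OF continuous_clinearD(1)[OF D]] intro!: bexI[of _ "\<lambda>t. \<Phi> t v"])
  then show ?thesis using st unfolding is_stable_def by blast
qed

lemma stable_imp_generalized_eigenvectors_in_kernel:
  assumes st: "is_stable T P" and \<mu>: "1 \<le> cmod \<mu>" and v: "v \<in> generalized_eigenvectors (\<Phi> 1) \<mu>"
  shows "C v = 0"
proof -
  let ?S = "\<Phi> 1" and ?T = "\<lambda>w. \<mu> *\<^sub>C w - \<Phi> 1 w"
  note S = clinear_\<Phi>[OF T_1] and Cl = continuous_clinearD(1)[OF C]
  note T' = clinear_scaleC_minus[OF S, of \<mu>]
  have "\<forall>v. (?T ^^ k) v = 0 \<longrightarrow> C v = 0" for k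
  proof (induction k)
    case 0
    then show ?case by (simp add: clinear_0[OF Cl])
  next
    case (Suc k)
    show ?case
    proof (intro allI impI)
      fix v assume v: "(?T ^^ Suc k) v = 0"
      have comm: "(?T ^^ j) ((?S ^^ n) w) = (?S ^^ n) ((?T ^^ j) w)" for j n w
      proof -
        have "?T ((?S ^^ n) w) = (?S ^^ n) (?T w)" for w
          using clinear_diff[OF clinear_funpow[OF S]] clinear_scaleC[OF clinear_funpow[OF S]]
          by (simp add: funpow_swap1)
        then show ?thesis by (induction j) simp_all
      qed
      \<comment> \<open>One application of \<open>?T\<close> lowers the order of \<open>v\<close>,
        and powers of \<open>?S\<close> preserve the order, so the induction hypothesis covers all
        these vectors.\<close>
      have step: "C ((?S ^^ n) (?T v)) = 0" for n
      proof -
        have "(?T ^^ k) (?T v) = 0" using v by (simp add: funpow_Suc_right del: funpow.simps)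
        then have "(?T ^^ k) ((?S ^^ n) (?T v)) = 0"
          unfolding comm by (simp add: clinear_0[OF clinear_funpow[OF S]])
        then show ?thesis using Suc by blast
      qed
      have pow: "C ((?S ^^ n) v) = \<mu> ^ n *\<^sub>C C v" for n
      proof (induction n)
        case 0
        then show ?case by (simp add: scaleC_one)
      next
        case (Suc n)
        have "?T ((?S ^^ n) v) = (?S ^^ n) (?T v)" using comm[of 1 n v] by simp
        then have "?S ((?S ^^ n) v) = \<mu> *\<^sub>C (?S ^^ n) v - (?S ^^ n) (?T v)"
          by (metis diff_diff_eq2 add_diff_cancel_left')
        then have "C ((?S ^^ Suc n) v) = C (\<mu> *\<^sub>C (?S ^^ n) v - (?S ^^ n) (?T v))" by simp
        also have "\<dots> = \<mu> *\<^sub>C C ((?S ^^ n) v)" by (simp only: clinear_diff[OF Cl] clinear_scaleC[OF Cl] step diff_zero)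
        finally show ?case using Suc by (simp add: scaleC_scaleC)
      qed
      have "v \<in> H"
        using generalized_eigenvectors_subset_unstable_space[OF \<mu>] v generalized_eigenvectors_iff by blast
      then have "((\<lambda>t. C (\<Phi> t v)) \<longlongrightarrow> 0) (inf at_top (principal T))"
        using stable_imp_orbit_vanishing[OF st] by (simp add: vanishing_def)
      \<comment> \<open>Sampling at integer times, which belong to both time sets, turns the orbit
        into powers of \<open>?S\<close>.\<close>
      moreover have "filterlim real (inf at_top (principal T)) sequentially"
        using filterlim_real_sequentially T_of_nat by (simp add: filterlim_inf filterlim_principal)
      ultimately have "(\<lambda>n. C (\<Phi> (real n) v)) \<longlonglongrightarrow> 0" by (rule filterlim_compose)
      then have lim: "(\<lambda>n. \<mu> ^ n *\<^sub>C C v) \<longlonglongrightarrow> 0" by (simp only: \<Phi>_of_nat pow)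
      \<comment> \<open>Since \<open>\<mu>\<close> has modulus at least 1, the seminorms of
        \<open>\<mu> ^ n *\<^sub>C C v\<close> cannot drop below that of \<open>C v\<close>, yet
        they tend to 0.\<close>
      have "frechet_seminorm m (C v) = 0" for m
      proof -
        note p = cseminorm_frechet_seminorm[of m]
        have "(\<lambda>n. frechet_seminorm m (\<mu> ^ n *\<^sub>C C v)) \<longlonglongrightarrow> 0"
          using lim unfolding tendsto_frechet_iff by simp
        moreover have "frechet_seminorm m (C v) \<le> frechet_seminorm m (\<mu> ^ n *\<^sub>C C v)" for n
          using mult_right_mono[OF one_le_power[OF \<mu>, of n] cseminorm_nonneg[OF p, of "C v"]]
          by (simp add: cseminorm_scaleC[OF p] norm_power)
        ultimately have "frechet_seminorm m (C v) \<le> 0" by (intro LIMSEQ_le_const) auto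
        then show ?thesis using cseminorm_nonneg[OF p, of "C v"] by simp
      qed
      then show "C v = 0" by (rule frechet_seminorm_eq_0D)
    qed
  qed
  then show ?thesis using v unfolding generalized_eigenvectors_iff by blast
qed

lemma unobservable_subspace_\<Phi>: "unobservable_subspace T \<Phi> C = {x. \<forall>t\<in>T. C (\<Phi> t x) = 0}"
  by (rule unobservable_subspace_eq[OF T \<Phi> continuous_clinearD(1)[OF C]])

text \<open>Reconciles condition (b), which speaks of eigenvalues, with \<open>H\<close>, which is
  spanned over all \<open>\<mu>\<close> outside the open disk. A nonzero last iterate before
  annihilation would be an eigenvector.\<close>

lemma generalized_eigenvectors_trivial:
  assumes "\<not> eigenvalue (\<Phi> 1) \<mu>" "v \<in> generalized_eigenvectors (\<Phi> 1) \<mu>"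
  shows "v = 0"
proof -
  have "w = 0" if "((\<lambda>w. \<mu> *\<^sub>C w - \<Phi> 1 w) ^^ k) w = 0" for k w
    using that
  proof (induction k)
    case (Suc k)
    let ?w = "((\<lambda>w. \<mu> *\<^sub>C w - \<Phi> 1 w) ^^ k) w"
    have "\<Phi> 1 ?w = \<mu> *\<^sub>C ?w" using Suc.prems by simp
    then have "?w = 0" using assms(1) unfolding eigenvalue_def by blast
    then show ?case by (rule Suc.IH)
  qed simp
  then show ?thesis using assms(2) unfolding generalized_eigenvectors_iff by blast
qed

lemma equivalences:
  "(is_stable T P \<longleftrightarrow>
      (\<forall>\<mu>. eigenvalue (\<Phi> 1) \<mu> \<and> cmod \<mu> \<ge> 1 \<longrightarrow>
        generalized_eigenvectors (\<Phi> 1) \<mu> \<subseteq> unobservable_subspace T \<Phi> C))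
    \<and> (is_stable T P \<longleftrightarrow> VIVO T P) \<and> (is_stable T P \<longleftrightarrow> smoothly_VIVO T P)"
  (is "(?a \<longleftrightarrow> ?b) \<and> (?a \<longleftrightarrow> ?c) \<and> (?a \<longleftrightarrow> ?d)")
proof -
  have "?b" if a: ?a
  proof (intro allI impI subsetI)
    fix \<mu> v assume \<mu>: "eigenvalue (\<Phi> 1) \<mu> \<and> cmod \<mu> \<ge> 1" and v: "v \<in> generalized_eigenvectors (\<Phi> 1) \<mu>"
    \<comment> \<open>\<open>\<Phi> t v\<close> is again a generalized eigenvector for
      \<open>\<mu>\<close>, so vanishing of \<open>C\<close> on such vectors already gives
      unobservability.\<close>
    have "C (\<Phi> t v) = 0" if t: "t \<in> T" for t
      using stable_imp_generalized_eigenvectors_in_kernel[OF a, of \<mu> "\<Phi> t v"] \<mu> v \<Phi>_invariant(2)[OF t] by blast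
    then show "v \<in> unobservable_subspace T \<Phi> C" unfolding unobservable_subspace_\<Phi> by blast
  qed
  moreover have "?c" if b: ?b
  proof (rule VIVO_if_unstable_space_in_kernel)
    have Cl: "clinear C" by (rule continuous_clinearD(1)[OF C])
    have "C v = 0" if "1 \<le> cmod \<mu>" "v \<in> generalized_eigenvectors (\<Phi> 1) \<mu>" for \<mu> v
    proof (cases "eigenvalue (\<Phi> 1) \<mu>")
      case True
      then have "v \<in> unobservable_subspace T \<Phi> C" using b that by blast
      then show ?thesis unfolding unobservable_subspace_\<Phi> using T_0 \<Phi>_0 by force
    next
      case False
      then show ?thesis using generalized_eigenvectors_trivial[OF False that(2)] clinear_0[OF Cl] by simp
    qed
    then have "(\<Union>\<mu>\<in>{\<mu>. 1 \<le> cmod \<mu>}. generalized_eigenvectors (\<Phi> 1) \<mu>) \<subseteq> {x. C x = 0}" by blast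
    then show "H \<subseteq> {x. C x = 0}"
      unfolding unstable_space_def
      by (rule complex_vector.span_minimal)
        (auto intro!: complex_vector.subspaceI simp: clinear_0[OF Cl] clinear_add[OF Cl] clinear_scaleC[OF Cl])
  qed
  ultimately show ?thesis
    using VIVO_imp_smoothly_VIVO VIVO_imp_stable smoothly_VIVO_imp_stable by blast
qed

end

theorem theorem4p9:
  fixes T :: "real set"
    and \<Phi> :: "real \<Rightarrow> 'x::complex_banach \<Rightarrow> 'x"
    and B :: "'u::frechet_space \<Rightarrow> 'x"
    and C :: "'x \<Rightarrow> 'y::frechet_space"
    and D :: "'u \<Rightarrow> 'y"
  defines "P \<equiv> system_relation T \<Phi> B C D"
  assumes "time_set T"
    and "semigroup_on T \<Phi>"
    and "continuous_clinear B"
    and "continuous_clinear C"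
    and "continuous_clinear D"
    and "compact_operator (\<Phi> 1)"
  shows "(is_stable T P \<longleftrightarrow>
            (\<forall>\<mu>. eigenvalue (\<Phi> 1) \<mu> \<and> cmod \<mu> \<ge> 1 \<longrightarrow>
                 generalized_eigenvectors (\<Phi> 1) \<mu> \<subseteq> unobservable_subspace T \<Phi> C))
       \<and> (is_stable T P \<longleftrightarrow> VIVO T P)
       \<and> (is_stable T P \<longleftrightarrow> smoothly_VIVO T P)"
proof -
  interpret linear_system T \<Phi> B C D
    using assms(2-) by unfold_locales
  show ?thesis unfolding P_def by (rule equivalences)
qed

end
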